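(* Let $X\subset\mathbb{R}^D$ and $f:X\to X$ be as in the context (an injective, non-singular, piecewise $C^1$-diffeomorphism with singular set $\Delta$), and let $\varepsilon\in(0,1)$. Let $p\geq1$, $z\in\Lambda_p\setminus\overline{\Lambda}_{p+1}$ and $\tau>0$. Let $u_n=\frac{-\ln\tau}{D}+b_n$ with $b_n$ such that $m(B(z,e^{-b_n}))=\left(n\,\varepsilon\sum_{k=0}^p(1-\varepsilon)^kJ_k(z)\right)^{-1}$ for all $n\ge1$. Then the process $Y_n(x,\underline\omega):=-\ln d(f^n_{\underline\omega}(x),z)$, $n\ge0$, on $(X\times\Omega_\varepsilon^{\mathbb{N}},\mathbb{P})$ satisfies condition $D'(u_n)$.
   Context: The map. $X\subset\mathbb{R}^D$ is compact with $X=\overline{\mathrm{int}(X)}$, $m$ is Lebesgue measure on $\mathbb{R}^D$ normalized so that $m(X)=1$, and $d$ is the metric induced by a norm on $\mathbb{R}^D$; $B(z,r)$ is the ball in $\mathbb{R}^D$ of center $z$ and radius $r$. $\{X_i\}_{i=1}^N$ is a collection of disjoint open sets (open in $\mathbb{R}^D$) contained in $X$ with $X=\bigcup_{i=1}^N\overline{X_i}$ and $m(\Delta)=0$, where $\Delta:=X\setminus\bigcup_{i=1}^N X_i$ is the singular set. The map $f:X\to X$ is non-singular with respect to $m$, injective on $X$, and $f|_{X\setminus\Delta}$ is a $C^1$-diffeomorphism onto its image. Notation. $\Lambda_0:=X$ and $\Lambda_{k+1}:=f(\Lambda_k\setminus\Delta)$ for $k\ge0$. $J_0:=1$ and, for $k\ge1$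 and $x\in\Lambda_k$, $J_k(x):=\prod_{l=1}^k|\det f'(f^{-l}(x))|^{-1}$. Randomly applied stochastic perturbation. Let $\Omega_\varepsilon=\{0,1\}\times X$ and let $\theta_\varepsilon$ be the product of the Bernoulli measure with weights $(\varepsilon,1-\varepsilon)$ on $\{0,1\}$ (so $0$ has probability $\varepsilon$) and the uniform measure $m$ on $X$. For $\omega=(\eta,\xi)\in\Omega_\varepsilon$ put $f_\omega(x)=\eta f(x)+(1-\eta)\xi$. For $\underline\omega=(\omega_1,\omega_2,\dots)\in\Omega_\varepsilon^{\mathbb{N}}$ put $f^0_{\underline\omega}(x)=x$ and $f^n_{\underline\omega}(x)=f_{\omega_n}\circ\cdots\circ f_{\omega_1}(x)$. Let $\mu_\varepsilon$ be the absolutely continuous stationary probability measure, i.e. $\mu_\varepsilon(A)=\int_X\int_{\Omega_\varepsilon}\mathbf 1_A(f_\omega(x))\,d\theta_\varepsilon(\omega)\,d\mu_\varepsilon(x)$ for all measurable $A\subset X$; its density is $\varepsilon\sum_{k\ge0}(1-\varepsilon)^kJ_k\mathbf 1_{\Lambda_k}$. Put $\mathbb{P}=\mu_\varepsilon\times\theta_\varepsilon^{\mathbb{N}}$. Conditions. With $M_\ell=\max\{Y_0,\dots,Y_{\ell-1}\}$, condition $D_2(u_n)$ holds if for all $\ell,t,n$, $|\mathbb{P}(Y_0>u_n,\ \max\{Y_t,\dots,Y_{t+\ell-1}\}\le u_n)-\mathbb{P}(Y_0>u_n)\mathbb{P}(M_\ell\le u_n)|\le\gamma(n,t)$, where $\gamma(n,t)$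 is decreasing in $t$ for each $n$ and $n\gamma(n,t_n)\to0$ for some sequence $t_n=o(n)$. Condition $D'(u_n)$ holds if there exists a sequence of integers $(k_n)$ with $k_n\to\infty$ and $k_nt_n=o(n)$, where $(t_n)$ is the sequence of condition $D_2(u_n)$, such that $$\lim_{n\to\infty}n\sum_{j=1}^{\lfloor n/k_n\rfloor}\mathbb{P}(Y_0>u_n,\ Y_j>u_n)=0.$$ *)

theory Defs
  imports "HOL-Probability.Probability"
begin

section \<open>The deterministic map\<close>

definition is_norm :: "('a::real_vector \<Rightarrow> real) \<Rightarrow> bool" where
  "is_norm \<nu> \<longleftrightarrow>
     (\<forall>x. \<nu> x = 0 \<longleftrightarrow> x = 0) \<and>
     (\<forall>c x. \<nu> (c *\<^sub>R x) = \<bar>c\<bar> * \<nu> x) \<and>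
     (\<forall>x y. \<nu> (x + y) \<le> \<nu> x + \<nu> y)"

definition norm_ball :: "('a::real_vector \<Rightarrow> real) \<Rightarrow> 'a \<Rightarrow> real \<Rightarrow> 'a set" where
  "norm_ball \<nu> z r = {x. \<nu> (x - z) < r}"

text \<open>A measure on the whole space, not only on \<open>X\<close>; only its value on \<open>X\<close> is normalized to 1.\<close>

definition normalized_lebesgue :: "'a::euclidean_space set \<Rightarrow> 'a measure" where
  "normalized_lebesgue X = scale_measure (inverse (emeasure lebesgue X)) lebesgue"

definition uniform_on :: "'a::euclidean_space set \<Rightarrow> 'a measure" where
  "uniform_on X = restrict_space (normalized_lebesgue X) X"

definition nonsingular :: "'a measure \<Rightarrow> ('a \<Rightarrow> 'a) \<Rightarrow> bool" where
  "nonsingular M f \<longleftrightarrow>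
     f \<in> measurable M M \<and> (\<forall>A\<in>null_sets M. f -` A \<inter> space M \<in> null_sets M)"

definition C1_on :: "'a::real_normed_vector set \<Rightarrow> ('a \<Rightarrow> 'b::real_normed_vector) \<Rightarrow> bool" where
  "C1_on U f \<longleftrightarrow>
     (\<exists>f' :: 'a \<Rightarrow> 'a \<Rightarrow>\<^sub>L 'b.
        (\<forall>x\<in>U. (f has_derivative blinfun_apply (f' x)) (at x)) \<and> continuous_on U f')"

definition C1_diffeo_onto_image ::
    "'a::real_normed_vector set \<Rightarrow> ('a \<Rightarrow> 'b::real_normed_vector) \<Rightarrow> bool" where
  "C1_diffeo_onto_image U f \<longleftrightarrow>
     open U \<and> open (f ` U) \<and> inj_on f U \<and> C1_on U f \<and> C1_on (f ` U) (inv_into U f)"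

fun Lam :: "'a set \<Rightarrow> 'a set \<Rightarrow> ('a \<Rightarrow> 'a) \<Rightarrow> nat \<Rightarrow> 'a set" where
  "Lam X \<Delta> f 0 = X"
| "Lam X \<Delta> f (Suc k) = f ` (Lam X \<Delta> f k - \<Delta>)"

text \<open>Meaningful for \<open>x \<in> Lam X \<Delta> f k\<close> and \<open>f\<close> injective on \<open>X\<close>: then
  \<open>(inv_into X f ^^ l) x\<close> is the unique preimage \<open>f\<^sup>-\<^sup>l(x)\<close>, it lies in the
  open set \<open>X - \<Delta>\<close>, and \<open>f\<close> is differentiable there. For \<open>k = 0\<close> the product is empty.\<close>

definition Jac :: "(real^'n) set \<Rightarrow> (real^'n \<Rightarrow> real^'n) \<Rightarrow> nat \<Rightarrow> real^'n \<Rightarrow> real" where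
  "Jac X f k x =
     (\<Prod>l=1..k. inverse \<bar>det (matrix (frechet_derivative f (at ((inv_into X f ^^ l) x))))\<bar>)"


section \<open>The random perturbation\<close>

text \<open>The symbol 1 of \<open>{0,1}\<close> is encoded as \<open>True\<close>.\<close>

definition noise :: "real \<Rightarrow> 'a::euclidean_space set \<Rightarrow> (bool \<times> 'a) measure" where
  "noise \<epsilon> X = measure_pmf (bernoulli_pmf (1 - \<epsilon>)) \<Otimes>\<^sub>M uniform_on X"

definition perturbed :: "('a::real_vector \<Rightarrow> 'a) \<Rightarrow> bool \<times> 'a \<Rightarrow> 'a \<Rightarrow> 'a" where
  "perturbed f = (\<lambda>(\<eta>, \<xi>) x. of_bool \<eta> *\<^sub>R f x + (1 - of_bool \<eta>) *\<^sub>R \<xi>)"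

text \<open>Noise sequences are indexed from 0, so \<open>w n\<close> is \<open>\<omega>\<^sub>n\<^sub>+\<^sub>1\<close>.\<close>

fun random_orbit :: "('a::real_vector \<Rightarrow> 'a) \<Rightarrow> (nat \<Rightarrow> bool \<times> 'a) \<Rightarrow> nat \<Rightarrow> 'a \<Rightarrow> 'a" where
  "random_orbit f w 0 x = x"
| "random_orbit f w (Suc n) x = perturbed f (w n) (random_orbit f w n x)"

definition stationary_acpm ::
    "real \<Rightarrow> 'a::euclidean_space set \<Rightarrow> ('a \<Rightarrow> 'a) \<Rightarrow> 'a measure \<Rightarrow> bool" where
  "stationary_acpm \<epsilon> X f \<mu> \<longleftrightarrow>
     sets \<mu> = sets (uniform_on X) \<and> prob_space \<mu> \<and> absolutely_continuous (uniform_on X) \<mu> \<and>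
     (\<forall>A\<in>sets \<mu>. emeasure \<mu> A =
        (\<integral>\<^sup>+ x. (\<integral>\<^sup>+ \<omega>. indicator A (perturbed f \<omega> x) \<partial>noise \<epsilon> X) \<partial>\<mu>))"

definition path_measure ::
    "real \<Rightarrow> 'a::euclidean_space set \<Rightarrow> 'a measure \<Rightarrow> ('a \<times> (nat \<Rightarrow> bool \<times> 'a)) measure" where
  "path_measure \<epsilon> X \<mu> = \<mu> \<Otimes>\<^sub>M (\<Pi>\<^sub>M i\<in>UNIV. noise \<epsilon> X)"

text \<open>Extended-real valued, because HOL has \<open>ln 0 = 0\<close> whereas \<open>-ln 0 = \<infinity>\<close> is meant.\<close>

definition obs_process ::
    "('a::real_vector \<Rightarrow> real) \<Rightarrow> ('a \<Rightarrow> 'a) \<Rightarrow> 'a \<Rightarrow> nat \<Rightarrow> 'a \<times> (nat \<Rightarrow> bool \<times> 'a) \<Rightarrow> ereal" where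
  "obs_process \<nu> f z n = (\<lambda>(x, w).
     let r = \<nu> (random_orbit f w n x - z) in if r = 0 then \<infinity> else ereal (- ln r))"


section \<open>The mixing and clustering conditions\<close>

text \<open>\<open>t\<close> is an admissible sequence for condition \<open>D\<^sub>2(u\<^sub>n)\<close>; the condition itself
  is \<open>\<exists>t. D2_seq P Y u t\<close>. The maxima are over nonempty index sets, hence \<open>\<ell> \<ge> 1\<close>.\<close>

definition D2_seq ::
    "'w measure \<Rightarrow> (nat \<Rightarrow> 'w \<Rightarrow> ereal) \<Rightarrow> (nat \<Rightarrow> real) \<Rightarrow> (nat \<Rightarrow> nat) \<Rightarrow> bool" where
  "D2_seq P Y u t \<longleftrightarrow>
     (\<exists>\<gamma> :: nat \<Rightarrow> nat \<Rightarrow> real.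
        (\<forall>l\<ge>1. \<forall>s n.
           \<bar>\<P>(\<omega> in P. Y 0 \<omega> > ereal (u n) \<and> Max ((\<lambda>i. Y i \<omega>) ` {s..<s + l}) \<le> ereal (u n))
            - \<P>(\<omega> in P. Y 0 \<omega> > ereal (u n))
              * \<P>(\<omega> in P. Max ((\<lambda>i. Y i \<omega>) ` {0..<l}) \<le> ereal (u n))\<bar> \<le> \<gamma> n s) \<and>
        (\<forall>n. antimono (\<gamma> n)) \<and>
        (\<lambda>n. real n * \<gamma> n (t n)) \<longlonglongrightarrow> 0 \<and>
        (\<lambda>n. real (t n)) \<in> o(\<lambda>n. real n))"

text \<open>Condition \<open>D'(u\<^sub>n)\<close> refers to ``the'' sequence \<open>t\<close> of condition \<open>D\<^sub>2(u\<^sub>n)\<close>, which is not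
  unique. The definition asks for a \<open>k\<close> for every admissible \<open>t\<close>, and, so that this is never
  vacuous, for an admissible \<open>t\<close> to exist.\<close>

definition cond_D' ::
    "'w measure \<Rightarrow> (nat \<Rightarrow> 'w \<Rightarrow> ereal) \<Rightarrow> (nat \<Rightarrow> real) \<Rightarrow> bool" where
  "cond_D' P Y u \<longleftrightarrow>
     (\<exists>t. D2_seq P Y u t) \<and>
     (\<forall>t. D2_seq P Y u t \<longrightarrow>
        (\<exists>k :: nat \<Rightarrow> nat.
           filterlim k at_top sequentially \<and>
           (\<lambda>n. real (k n * t n)) \<in> o(\<lambda>n. real n) \<and>
           (\<lambda>n. real n * (\<Sum>j=1..n div k n.
              \<P>(\<omega> in P. Y 0 \<omega> > ereal (u n) \<and> Y j \<omega> > ereal (u n)))) \<longlonglongrightarrow> 0))"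

end

theory Submission
  imports Defs "HOL-Real_Asymp.Real_Asymp"
begin

text \<open>
  At each time step the orbit is redrawn uniformly with probability \<open>\<epsilon>\<close>, and after a redrawing
  nothing is remembered. Hence the mean of a function \<open>h\<close> of the state after \<open>s\<close> steps, started at
  \<open>x\<close>, is \<open>(1 - \<epsilon>) ^ s * h ((f ^^ s) x)\<close> plus a constant \<open>refreshed s h\<close>
  (\<open>nn_integral_random_orbit\<close>). Integrating over the stationary measure \<open>\<mu>\<close> shows that the integral
  of \<open>h\<close> itself contains the same constant (\<open>nn_integral_stationary\<close>). Two consequences follow
  for the ball \<open>A\<close> of radius \<open>exp (- u)\<close> around \<open>z\<close>, where \<open>A\<close> is the event of an exceedance at
  time 0.

  First, an exceedance at time 0 and any event that starts at time \<open>s\<close> are independent up to an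
  error \<open>(1 - \<epsilon>) ^ s\<close> (\<open>exponential_mixing\<close>). This gives the mixing condition with gap \<open>sqrt n\<close>,
  so admissible gap sequences exist.

  Second, exceedances at times 0 and \<open>j\<close> occur together with probability at most
  \<open>(1 - \<epsilon>) ^ j * \<mu> (A \<inter> (f ^^ j) -` A) + (\<mu> A)\<^sup>2\<close>. The first term vanishes for small balls: off a
  null set, an orbit of \<open>f\<close> that starts near \<open>z\<close> never comes back near \<open>z\<close>
  (\<open>no_return_neighbourhood\<close>). After more than \<open>p\<close> steps it is in \<open>Lam X \<Delta> f (Suc p)\<close>, away from
  \<open>z\<close>; a return after at most \<open>p\<close> steps, arbitrarily close to \<open>z\<close>, would make \<open>z\<close> periodic,
  by continuity of the inverse branches, and a periodic point with smooth orbit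
  belongs to all the sets \<open>Lam X \<Delta> f k\<close>.

  It remains to see that \<open>n * \<mu> A\<close> is bounded at level \<open>u n\<close>. By scaling, the volume of the ball is
  \<open>\<tau>\<close> times the prescribed one, thus \<open>O(1 / n)\<close>. Almost no orbit reaches \<open>A\<close> by
  \<open>p + 1\<close> consecutive applications of \<open>f\<close>, so the measure \<open>\<mu> A\<close> is at most the sum of the volumes
  of the preimages of \<open>A\<close> under the iterates of order at most \<open>p\<close> (\<open>measure_stationary_le\<close>), and these lie in balls of comparable radius because the inverse
  branches are differentiable (\<open>preimage_norm_ball_subset\<close>). Then \<open>n\<close> times the sum of \<open>n div k\<close>
  terms \<open>(\<mu> A)\<^sup>2\<close> is \<open>O(1 / k)\<close>, and for every gap sequence \<open>t\<close> of smaller order than \<open>n\<close> there is a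
  \<open>k\<close> that tends to infinity with \<open>k * t\<close> still of smaller order than \<open>n\<close> (\<open>block_count_exists\<close>).
\<close>

section \<open>Balls of a norm\<close>

lemma is_norm_nonneg:
  assumes "is_norm \<nu>"
  shows "0 \<le> \<nu> x"
proof -
  have hom: "\<nu> (c *\<^sub>R x) = \<bar>c\<bar> * \<nu> x" and tri: "\<nu> (x + y) \<le> \<nu> x + \<nu> y" and zero: "\<nu> 0 = 0" for c x y
    using assms by (auto simp: is_norm_def)
  show ?thesis using tri[of x "- x"] hom[of "-1" x] by (simp add: zero)
qed

text \<open>Finite dimension: the values of \<open>\<nu>\<close> on a basis bound it from above, and its
  minimum on the compact Euclidean unit sphere bounds it from below.\<close>

lemma is_norm_equivalent:
  fixes \<nu> :: "'a::euclidean_space \<Rightarrow> real"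
  assumes "is_norm \<nu>"
  obtains c C where "c > 0" "C > 0" "\<And>x. c * norm x \<le> \<nu> x" "\<And>x. \<nu> x \<le> C * norm x"
    "continuous_on UNIV \<nu>"
proof -
  have hom: "\<nu> (c *\<^sub>R x) = \<bar>c\<bar> * \<nu> x" and tri: "\<nu> (x + y) \<le> \<nu> x + \<nu> y" and
    zero: "\<nu> x = 0 \<longleftrightarrow> x = 0" for c x y
    using assms by (auto simp: is_norm_def)
  have minus: "\<nu> (- x) = \<nu> x" for x using hom[of "-1" x] by simp
  have nonneg: "0 \<le> \<nu> x" for x using is_norm_nonneg[OF assms] .
  define C where "C = (\<Sum>b\<in>Basis. \<nu> b)"
  have sum_tri: "\<nu> (\<Sum>b\<in>S. g b) \<le> (\<Sum>b\<in>S. \<nu> (g b))" if "finite S" for S :: "'a set" and g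
    using that
  proof induction
    case (insert b S)
    then show ?case using tri[of "g b" "sum g S"] by simp
  qed (use zero[of 0] in simp)
  have upper: "\<nu> x \<le> C * norm x" for x
  proof -
    have "\<nu> x = \<nu> (\<Sum>b\<in>Basis. (x \<bullet> b) *\<^sub>R b)" by (simp add: euclidean_representation)
    also have "\<dots> \<le> (\<Sum>b\<in>Basis. \<bar>x \<bullet> b\<bar> * \<nu> b)"
      using sum_tri[of Basis "\<lambda>b. (x \<bullet> b) *\<^sub>R b"] by (simp add: hom)
    also have "\<dots> \<le> (\<Sum>b\<in>Basis. norm x * \<nu> b)"
      by (intro sum_mono mult_right_mono nonneg) (rule Basis_le_norm)
    finally show ?thesis by (simp add: C_def sum_distrib_left mult.commute)
  qed
  have "\<bar>\<nu> x - \<nu> y\<bar> \<le> C * norm (x - y)" for x y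
    using tri[of "x - y" y] tri[of "y - x" x] upper[of "x - y"] minus[of "x - y"] by simp
  then have "C-lipschitz_on UNIV \<nu>"
    using nonneg by (intro lipschitz_onI) (auto simp: dist_real_def dist_norm C_def sum_nonneg)
  then have cont: "continuous_on UNIV \<nu>" by (rule lipschitz_on_continuous_on)
  have "compact (sphere (0::'a) 1)" "sphere (0::'a) 1 \<noteq> {}" by auto
  moreover have "continuous_on (sphere 0 1) \<nu>"
    using cont continuous_on_subset by blast
  ultimately obtain y where y: "y \<in> sphere 0 1" "\<And>x. x \<in> sphere 0 1 \<Longrightarrow> \<nu> y \<le> \<nu> x"
    using continuous_attains_inf by (metis (no_types))
  have "y \<noteq> 0" using y(1) by auto
  then have "\<nu> y > 0" using zero[of y] nonneg[of y] by linarith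
  moreover have "\<nu> y * norm x \<le> \<nu> x" for x
  proof (cases "x = 0")
    case False
    then have "inverse (norm x) *\<^sub>R x \<in> sphere 0 1" by simp
    from y(2)[OF this] have "\<nu> y \<le> \<nu> x / norm x" by (simp add: hom divide_inverse mult.commute)
    then show ?thesis using False by (simp add: field_simps)
  qed (use zero[of 0] in simp)
  moreover have "\<nu> x \<le> (C + 1) * norm x" for x
    using upper[of x] norm_ge_zero[of x] unfolding distrib_right by linarith
  moreover have "0 < C + 1" using nonneg by (simp add: C_def sum_nonneg add_nonneg_pos)
  ultimately show ?thesis using cont by (intro that[of "\<nu> y" "C + 1"]) auto
qed

lemma open_norm_ball:
  fixes \<nu> :: "'a::euclidean_space \<Rightarrow> real"
  assumes "is_norm \<nu>"
  shows "open (norm_ball \<nu> z r)"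
proof -
  have cont: "continuous_on UNIV \<nu>" by (rule is_norm_equivalent[OF assms])
  show ?thesis
    unfolding norm_ball_def
    by (intro open_Collect_less continuous_intros continuous_on_compose2[OF cont]) auto
qed

lemma norm_ball_subset_open:
  fixes \<nu> :: "'a::euclidean_space \<Rightarrow> real"
  assumes "is_norm \<nu>" "open V" "z \<in> V"
  obtains r where "r > 0" "norm_ball \<nu> z r \<subseteq> V"
proof -
  obtain e where e: "e > 0" "ball z e \<subseteq> V" using assms(2,3) by (meson open_contains_ball)
  obtain c where c: "c > 0" "\<And>x. c * norm x \<le> \<nu> x"
    by (rule is_norm_equivalent[OF assms(1)]) (rule that)
  have "norm_ball \<nu> z (c * e) \<subseteq> ball z e"
  proof
    fix x assume "x \<in> norm_ball \<nu> z (c * e)"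
    then have "c * norm (x - z) < c * e" using c(2)[of "x - z"] by (simp add: norm_ball_def)
    then show "x \<in> ball z e" using c(1) by (simp add: dist_norm norm_minus_commute)
  qed
  then show ?thesis using that[of "c * e"] e c by auto
qed

text \<open>Balls of a norm are homothetic, whatever their centres. The scaling law of the volume that
  follows from this both relates the levels \<open>u\<close> and \<open>b\<close> and bounds the volume of preimages
  of small balls.\<close>

lemma norm_ball_scale:
  fixes \<nu> :: "'a::euclidean_space \<Rightarrow> real"
  assumes "is_norm \<nu>" "c > 0"
  shows "norm_ball \<nu> w (c * r) = (\<lambda>x. c *\<^sub>R x + (w - c *\<^sub>R z)) ` norm_ball \<nu> z r"
proof (intro set_eqI iffI)
  fix x assume "x \<in> norm_ball \<nu> w (c * r)"
  then have "\<nu> (x - w) < c * r" by (simp add: norm_ball_def)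
  then have "inverse c * \<nu> (x - w) < r" using \<open>c > 0\<close> by (simp add: field_simps)
  moreover have "\<nu> (inverse c *\<^sub>R (x - w)) = inverse c * \<nu> (x - w)"
    using assms by (simp add: is_norm_def)
  ultimately have "z + inverse c *\<^sub>R (x - w) \<in> norm_ball \<nu> z r"
    by (simp add: norm_ball_def)
  moreover have "x = c *\<^sub>R (z + inverse c *\<^sub>R (x - w)) + (w - c *\<^sub>R z)"
    using \<open>c > 0\<close> by (simp add: algebra_simps)
  ultimately show "x \<in> (\<lambda>x. c *\<^sub>R x + (w - c *\<^sub>R z)) ` norm_ball \<nu> z r" by blast
next
  fix x assume "x \<in> (\<lambda>x. c *\<^sub>R x + (w - c *\<^sub>R z)) ` norm_ball \<nu> z r"
  then obtain y where "y \<in> norm_ball \<nu> z r" "x = c *\<^sub>R y + (w - c *\<^sub>R z)" by blast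
  moreover from this have "x - w = c *\<^sub>R (y - z)" by (simp add: algebra_simps)
  moreover have "\<nu> (c *\<^sub>R (y - z)) = c * \<nu> (y - z)" using assms by (simp add: is_norm_def)
  ultimately show "x \<in> norm_ball \<nu> w (c * r)" using \<open>c > 0\<close> by (simp add: norm_ball_def)
qed

section \<open>Normalized Lebesgue measure\<close>

lemma measure_normalized_lebesgue:
  "measure (normalized_lebesgue X) A = measure lebesgue A * enn2real (inverse (emeasure lebesgue X))"
  by (simp add: normalized_lebesgue_def measure_def enn2real_mult mult.commute)

lemma measure_norm_ball_scale:
  fixes X :: "'a::euclidean_space set"
  assumes "is_norm \<nu>" "c > 0"
  shows "measure (normalized_lebesgue X) (norm_ball \<nu> w (c * r))
    = c ^ DIM('a) * measure (normalized_lebesgue X) (norm_ball \<nu> z r)"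
  using \<open>c > 0\<close>
  by (simp add: measure_normalized_lebesgue norm_ball_scale[OF assms, of w r z]
      measure_lebesgue_affine)

lemma sets_uniform_on:
  fixes X :: "'a::euclidean_space set"
  assumes "X \<in> sets lebesgue"
  shows "A \<in> sets (uniform_on X) \<longleftrightarrow> A \<subseteq> X \<and> A \<in> sets lebesgue"
  using assms sets_restrict_space_iff[of X "normalized_lebesgue X" A]
  by (simp add: uniform_on_def normalized_lebesgue_def)

lemma space_uniform_on: "space (uniform_on X) = X"
  by (simp add: uniform_on_def normalized_lebesgue_def space_restrict_space space_scale_measure)

lemma emeasure_uniform_on:
  fixes X :: "'a::euclidean_space set"
  assumes "X \<in> sets lebesgue" "A \<subseteq> X"
  shows "emeasure (uniform_on X) A = inverse (emeasure lebesgue X) * emeasure lebesgue A"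
  using assms by (simp add: uniform_on_def normalized_lebesgue_def emeasure_restrict_space)

text \<open>The interior of \<open>X\<close> makes its volume positive, compactness makes it finite.\<close>

lemma emeasure_lebesgue_regular_compact:
  fixes X :: "'a::euclidean_space set"
  assumes "compact X" "X = closure (interior X)" "X \<noteq> {}"
  shows "X \<in> sets lebesgue" "emeasure lebesgue X \<noteq> 0" "emeasure lebesgue X \<noteq> \<infinity>"
proof -
  show X: "X \<in> sets lebesgue" using lmeasurable_compact[OF assms(1)] by (rule fmeasurableD)
  have "interior X \<noteq> {}" using assms(2,3) by fastforce
  then have "interior X \<notin> null_sets lebesgue"
    using open_not_negligible[of "interior X"] by (simp add: negligible_iff_null_sets)
  then have "X \<notin> null_sets lebesgue"
    by (metis interior_subset negligible_iff_null_sets negligible_subset)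
  then show "emeasure lebesgue X \<noteq> 0" using X by auto
  show "emeasure lebesgue X \<noteq> \<infinity>" using lmeasurable_compact[OF assms(1)]
    by (auto simp: fmeasurable_def)
qed

lemma prob_space_uniform_on:
  fixes X :: "'a::euclidean_space set"
  assumes "X \<in> sets lebesgue" "emeasure lebesgue X \<noteq> 0" "emeasure lebesgue X \<noteq> \<infinity>"
  shows "prob_space (uniform_on X)"
proof
  show "emeasure (uniform_on X) (space (uniform_on X)) = 1"
    unfolding space_uniform_on emeasure_uniform_on[OF assms(1) order.refl]
    using assms(2,3) ennreal_divide_self[of "emeasure lebesgue X"]
    by (simp add: divide_ennreal_def mult.commute top.not_eq_extremum del: emeasure_completion)
qed

section \<open>Preimages and returns near a point of finite depth\<close>

locale piecewise_diffeo =
  fixes X \<Delta> :: "'a::euclidean_space set" and f :: "'a \<Rightarrow> 'a"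
  assumes f_into: "f ` X \<subseteq> X" and f_inj: "inj_on f X"
    and f_diffeo: "C1_diffeo_onto_image (X - \<Delta>) f"
begin

abbreviation "smooth_until n x \<equiv> \<forall>i<n. (f ^^ i) x \<in> X - \<Delta>"

lemma Lam_subset: "Lam X \<Delta> f k \<subseteq> X"
  using f_into by (induction k) auto

lemma Lam_iff: "y \<in> Lam X \<Delta> f k \<longleftrightarrow> (\<exists>w\<in>X. smooth_until k w \<and> (f ^^ k) w = y)"
proof (induction k arbitrary: y)
  case (Suc k)
  have "y \<in> Lam X \<Delta> f (Suc k) \<longleftrightarrow> (\<exists>v. v \<in> Lam X \<Delta> f k \<and> v \<in> X - \<Delta> \<and> y = f v)"
    using Lam_subset by auto
  also have "\<dots> \<longleftrightarrow> (\<exists>w\<in>X. smooth_until (Suc k) w \<and> (f ^^ Suc k) w = y)"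
    unfolding Suc.IH by (auto simp: less_Suc_eq)
  finally show ?case .
qed auto

lemma funpow_Lam:
  assumes "x \<in> Lam X \<Delta> f q" "smooth_until j x"
  shows "(f ^^ j) x \<in> Lam X \<Delta> f (q + j)"
  using assms by (induction j) auto

lemma Lam_antimono: "k \<le> j \<Longrightarrow> Lam X \<Delta> f j \<subseteq> Lam X \<Delta> f k"
proof -
  have "Lam X \<Delta> f (Suc k) \<subseteq> Lam X \<Delta> f k" for k
  proof (induction k)
    case (Suc k)
    then show ?case by auto
  qed (use Lam_subset[of "Suc 0"] in simp)
  then show "k \<le> j \<Longrightarrow> Lam X \<Delta> f j \<subseteq> Lam X \<Delta> f k" by (rule lift_Suc_antimono_le)
qed

lemma Lam_preimage:
  assumes "z \<in> Lam X \<Delta> f p" "j \<le> p"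
  obtains w where "w \<in> X" "smooth_until j w" "(f ^^ j) w = z"
  using Lam_antimono[OF assms(2)] assms(1) Lam_iff[of z j] by blast

text \<open>A local inverse of \<open>f\<close> is differentiable at \<open>f w\<close>, so near that point it is continuous and
  stretches distances to \<open>f w\<close> by at most \<open>L\<close>. Injectivity on all of \<open>X\<close> makes it
  control every preimage in \<open>X\<close>, not only those close to \<open>w\<close>.\<close>

lemma inverse_branch_step:
  assumes w: "w \<in> X - \<Delta>" and S: "open S" "w \<in> S"
  obtains V L where "open V" "f w \<in> V" "L > 0"
    "\<And>x. x \<in> X \<Longrightarrow> f x \<in> V \<Longrightarrow> x \<in> S \<and> norm (x - w) \<le> L * norm (f x - f w)"
proof -
  define g where "g = inv_into (X - \<Delta>) f"
  have inj: "inj_on f (X - \<Delta>)" and opn: "open (f ` (X - \<Delta>))"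
    and "C1_on (f ` (X - \<Delta>)) g"
    using f_diffeo by (auto simp: C1_diffeo_onto_image_def g_def)
  then obtain g' where g': "(g has_derivative blinfun_apply g') (at (f w))"
    using w by (auto simp: C1_on_def)
  have gf: "g (f x) = x" if "x \<in> X - \<Delta>" for x
    unfolding g_def using inj that by (rule inv_into_f_f)
  have preimage: "x \<in> X - \<Delta>" if "x \<in> X" "f x \<in> f ` (X - \<Delta>)" for x
    using that f_inj by (auto dest: inj_onD)
  obtain d where d: "d > 0" "\<And>y. norm (y - f w) < d \<Longrightarrow>
      norm (g y - g (f w) - blinfun_apply g' (y - f w)) \<le> 1 * norm (y - f w)"
    using g' zero_less_one unfolding has_derivative_at_alt by blast
  define L where "L = norm g' + 1"
  have L: "L > 0" unfolding L_def by (simp add: add_nonneg_pos)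
  have lip: "norm (g y - w) \<le> L * norm (y - f w)" if "norm (y - f w) < d" for y
  proof -
    have "norm (g y - w) \<le> norm (g y - w - blinfun_apply g' (y - f w)) + norm (blinfun_apply g' (y - f w))"
      using norm_triangle_ineq[of "g y - w - blinfun_apply g' (y - f w)" "blinfun_apply g' (y - f w)"]
      by simp
    also have "\<dots> \<le> norm (y - f w) + norm g' * norm (y - f w)"
      using d(2)[OF that] gf[OF w] norm_blinfun[of g' "y - f w"] by simp
    finally show ?thesis by (simp add: L_def algebra_simps)
  qed
  obtain e where e: "e > 0" "ball w e \<subseteq> S" using S by (meson open_contains_ball)
  define V where "V = f ` (X - \<Delta>) \<inter> ball (f w) (min d (e / L))"
  show ?thesis
  proof
    show "open V" unfolding V_def using opn by auto
    show "f w \<in> V" unfolding V_def using w d(1) e(1) L by auto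
    show "L > 0" by (rule L)
    fix x assume x: "x \<in> X" "f x \<in> V"
    then have "x \<in> X - \<Delta>" using preimage by (auto simp: V_def)
    moreover have near: "norm (f x - f w) < d" "norm (f x - f w) < e / L"
      using x by (auto simp: V_def dist_norm norm_minus_commute)
    ultimately have "norm (x - w) \<le> L * norm (f x - f w)" using lip gf by metis
    moreover from this have "norm (x - w) < e"
      using near(2) L by (simp add: field_simps)
    ultimately show "x \<in> S \<and> norm (x - w) \<le> L * norm (f x - f w)"
      using e(2) by (auto simp: dist_norm norm_minus_commute)
  qed
qed

text \<open>The estimate for \<open>f\<close> passes to iterates by taking, as target of the inverse of \<open>f ^^ j\<close>
  near \<open>(f ^^ j) w\<close>, the neighbourhood of \<open>f w\<close> on which one more inverse step is controlled.\<close>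

lemma inverse_branch:
  assumes "w \<in> X" "smooth_until j w" "open S" "w \<in> S"
  obtains V L where "open V" "(f ^^ j) w \<in> V" "L > 0"
    "\<And>x. x \<in> X \<Longrightarrow> (f ^^ j) x \<in> V \<Longrightarrow> x \<in> S \<and> norm (x - w) \<le> L * norm ((f ^^ j) x - (f ^^ j) w)"
proof -
  have "\<exists>V L. open V \<and> (f ^^ j) w \<in> V \<and> L > 0 \<and> (\<forall>x\<in>X. (f ^^ j) x \<in> V \<longrightarrow>
      x \<in> S \<and> norm (x - w) \<le> L * norm ((f ^^ j) x - (f ^^ j) w))"
    using assms
  proof (induction j arbitrary: w S)
    case 0
    then show ?case by (intro exI[of _ S] exI[of _ 1]) auto
  next
    case (Suc j)
    have w: "w \<in> X - \<Delta>" using Suc.prems(2) by force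
    obtain V1 L1 where V1: "open V1" "f w \<in> V1" "L1 > 0"
      "\<And>x. x \<in> X \<Longrightarrow> f x \<in> V1 \<Longrightarrow> x \<in> S \<and> norm (x - w) \<le> L1 * norm (f x - f w)"
      using inverse_branch_step[OF w Suc.prems(3,4)] by blast
    have "f w \<in> X" using w f_into by blast
    moreover have "smooth_until j (f w)"
      using Suc.prems(2) by (metis Suc_less_eq comp_apply funpow_Suc_right)
    ultimately obtain V L where V: "open V" "(f ^^ j) (f w) \<in> V" "L > 0"
      "\<forall>x\<in>X. (f ^^ j) x \<in> V \<longrightarrow>
        x \<in> V1 \<and> norm (x - f w) \<le> L * norm ((f ^^ j) x - (f ^^ j) (f w))"
      using Suc.IH[OF _ _ V1(1,2)] by blast
    have "x \<in> S \<and> norm (x - w) \<le> (L1 * L) * norm ((f ^^ Suc j) x - (f ^^ Suc j) w)"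
      if x: "x \<in> X" "(f ^^ Suc j) x \<in> V" for x
    proof -
      have fx: "f x \<in> V1" "norm (f x - f w) \<le> L * norm ((f ^^ j) (f x) - (f ^^ j) (f w))"
        using V(4) x f_into by (auto simp: funpow_swap1)
      have "norm (x - w) \<le> L1 * norm (f x - f w)" using V1(4)[OF x(1) fx(1)] by simp
      also have "\<dots> \<le> L1 * (L * norm ((f ^^ j) (f x) - (f ^^ j) (f w)))"
        using V1(3) fx(2) by simp
      finally show ?thesis using V1(4)[OF x(1) fx(1)] by (simp add: funpow_swap1 mult.assoc)
    qed
    then show ?case using V V1(3)
      by (intro exI[of _ V] exI[of _ "L1 * L"]) (auto simp: funpow_swap1)
  qed
  then show ?thesis using that by blast
qed

text \<open>A periodic orbit off the singular set can be followed forever, which would put \<open>z\<close> in every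
  \<open>Lam X \<Delta> f k\<close>.\<close>

lemma not_periodic:
  assumes "z \<in> Lam X \<Delta> f p" "z \<notin> Lam X \<Delta> f (Suc p)" "j \<ge> 1" "smooth_until j z"
  shows "(f ^^ j) z \<noteq> z"
proof
  assume per: "(f ^^ j) z = z"
  have "z \<in> Lam X \<Delta> f (p + j * n)" for n
  proof (induction n)
    case (Suc n)
    from funpow_Lam[OF this assms(4)] show ?case by (simp add: per ac_simps)
  qed (use assms in simp)
  from this[of 1] have "z \<in> Lam X \<Delta> f (p + j)" by simp
  then show False using Lam_antimono[of "Suc p" "p + j"] assms(2,3) by auto
qed

text \<open>Returns after more than \<open>p\<close> steps land in \<open>Lam X \<Delta> f (Suc p)\<close>, whose closure misses \<open>z\<close>.
  A return after \<open>j \<le> p\<close> steps to a point very close to \<open>z\<close> must, by continuity of the inverse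
  branch, start very close to the preimage \<open>w \<noteq> z\<close> of \<open>z\<close>, hence away from \<open>z\<close>. Working with
  preimages matters: \<open>z\<close> itself may be singular, and then \<open>f\<close> need not be continuous there.\<close>

lemma no_return_neighbourhood:
  assumes z: "z \<in> Lam X \<Delta> f p - closure (Lam X \<Delta> f (Suc p))"
  obtains V where "open V" "z \<in> V" "V \<inter> Lam X \<Delta> f (Suc p) = {}"
    "\<And>x j. x \<in> X \<Longrightarrow> j \<ge> 1 \<Longrightarrow> smooth_until j x \<Longrightarrow> x \<in> V \<Longrightarrow> (f ^^ j) x \<notin> V"
proof -
  have "z \<notin> Lam X \<Delta> f (Suc p)" using z closure_subset by blast
  have "\<exists>V. open V \<and> z \<in> V \<and> (\<forall>x\<in>X. x \<in> V \<longrightarrow> (f ^^ j) x \<notin> V)" if j: "j \<in> {1..p}" for j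
  proof -
    obtain w where w: "w \<in> X" "smooth_until j w" "(f ^^ j) w = z"
      using Lam_preimage[of z p j] z j by auto
    have "w \<noteq> z" using not_periodic[of z p j] w z j \<open>z \<notin> Lam X \<Delta> f (Suc p)\<close> by auto
    then obtain S T where ST: "open S" "open T" "w \<in> S" "z \<in> T" "S \<inter> T = {}"
      using hausdorff by metis
    obtain V L where V: "open V" "(f ^^ j) w \<in> V"
      "\<And>x. x \<in> X \<Longrightarrow> (f ^^ j) x \<in> V \<Longrightarrow> x \<in> S \<and> norm (x - w) \<le> L * norm ((f ^^ j) x - (f ^^ j) w)"
      using inverse_branch[OF w(1,2) ST(1,3)] by metis
    have "open (V \<inter> T)" "z \<in> V \<inter> T" using V ST w(3) by auto
    moreover have "(f ^^ j) x \<notin> V \<inter> T" if "x \<in> X" "x \<in> V \<inter> T" for x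
      using V(3)[of x] that ST(5) by auto
    ultimately show ?thesis by blast
  qed
  then obtain V where V: "\<And>j. j \<in> {1..p} \<Longrightarrow> open (V j) \<and> z \<in> V j \<and> (\<forall>x\<in>X. x \<in> V j \<longrightarrow> (f ^^ j) x \<notin> V j)"
    by metis
  define W where "W = (\<Inter>j\<in>{1..p}. V j) \<inter> - closure (Lam X \<Delta> f (Suc p))"
  show ?thesis
  proof
    show "open W" unfolding W_def using V by (intro open_Int open_INT) auto
    show "z \<in> W" unfolding W_def using V z by auto
    show disj: "W \<inter> Lam X \<Delta> f (Suc p) = {}"
      unfolding W_def using closure_subset[of "Lam X \<Delta> f (Suc p)"] by blast
    fix x j assume x: "x \<in> X" "j \<ge> (1::nat)" "smooth_until j x" "x \<in> W"
    show "(f ^^ j) x \<notin> W"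
    proof (cases "j \<le> p")
      case True
      then have "j \<in> {1..p}" using x by simp
      then have "W \<subseteq> V j" "(f ^^ j) x \<notin> V j" using V[of j] x by (auto simp: W_def)
      then show ?thesis by blast
    next
      case False
      have "(f ^^ j) x \<in> Lam X \<Delta> f j" using x by (auto simp: Lam_iff)
      then show ?thesis using disj Lam_antimono[of "Suc p" j] False by auto
    qed
  qed
qed

text \<open>A linear bound on the radius suffices to compare volumes, by translation invariance and the
  scaling law.\<close>

lemma preimage_norm_ball_subset:
  assumes "z \<in> Lam X \<Delta> f p" "j \<le> p" and \<nu>: "is_norm \<nu>"
  obtains w K r0 where "K > 0" "r0 > 0"
    "\<And>r. r \<le> r0 \<Longrightarrow> {x \<in> X. (f ^^ j) x \<in> norm_ball \<nu> z r} \<subseteq> norm_ball \<nu> w (K * r)"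
proof -
  obtain w where w: "w \<in> X" "smooth_until j w" "(f ^^ j) w = z"
    using Lam_preimage assms(1,2) by blast
  obtain V L where V: "open V" "z \<in> V" "L > 0"
    "\<And>x. x \<in> X \<Longrightarrow> (f ^^ j) x \<in> V \<Longrightarrow> norm (x - w) \<le> L * norm ((f ^^ j) x - z)"
    using inverse_branch[OF w(1,2) open_UNIV UNIV_I] w(3) by metis
  obtain c C where cC: "c > 0" "C > 0" "\<And>x. c * norm x \<le> \<nu> x" "\<And>x. \<nu> x \<le> C * norm x"
    by (rule is_norm_equivalent[OF \<nu>]) (rule that)
  obtain r0 where r0: "r0 > 0" "norm_ball \<nu> z r0 \<subseteq> V"
    by (rule norm_ball_subset_open[OF \<nu> V(1,2)])
  show ?thesis
  proof
    show "C * L / c > 0" using cC V by simp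
    show "r0 > 0" by (rule r0)
    fix r assume "r \<le> r0"
    show "{x \<in> X. (f ^^ j) x \<in> norm_ball \<nu> z r} \<subseteq> norm_ball \<nu> w (C * L / c * r)"
    proof safe
      fix x assume x: "x \<in> X" "(f ^^ j) x \<in> norm_ball \<nu> z r"
      then have less: "\<nu> ((f ^^ j) x - z) < r" by (simp add: norm_ball_def)
      then have "(f ^^ j) x \<in> V" using r0 \<open>r \<le> r0\<close> by (auto simp: norm_ball_def)
      then have "C * norm (x - w) \<le> C * L * norm ((f ^^ j) x - z)" using V(4) x cC by simp
      also have "\<dots> = C * L / c * (c * norm ((f ^^ j) x - z))" using cC by simp
      also have "\<dots> \<le> C * L / c * \<nu> ((f ^^ j) x - z)"
        using cC V by (intro mult_left_mono) auto
      also have "\<dots> < C * L / c * r" using less cC V by (intro mult_strict_left_mono) auto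
      finally have "\<nu> (x - w) < C * L / c * r" using cC(4)[of "x - w"] by linarith
      then show "x \<in> norm_ball \<nu> w (C * L / c * r)" by (simp add: norm_ball_def)
    qed
  qed
qed

end

section \<open>Orbits of the random perturbation\<close>

locale random_map =
  fixes \<epsilon> :: real and X :: "'a::euclidean_space set" and f :: "'a \<Rightarrow> 'a"
  assumes eps: "0 < \<epsilon>" "\<epsilon> < 1"
    and prob_uniform: "prob_space (uniform_on X)"
    and f_measurable [measurable]: "f \<in> measurable (uniform_on X) (uniform_on X)"
begin

abbreviation "unif \<equiv> uniform_on X"
abbreviation "noise_seq \<equiv> (\<Pi>\<^sub>M i\<in>(UNIV :: nat set). noise \<epsilon> X)"

sublocale U: prob_space unif by (rule prob_uniform)

sublocale UN: pair_prob_space "measure_pmf (bernoulli_pmf (1 - \<epsilon>))" unif ..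

lemma prob_noise: "prob_space (noise \<epsilon> X)"
  unfolding noise_def by (rule UN.prob_space_axioms)

sublocale N: prob_space "noise \<epsilon> X" by (rule prob_noise)

sublocale W: sequence_space "noise \<epsilon> X" ..

lemma space_noise: "space (noise \<epsilon> X) = UNIV \<times> X"
  by (simp add: noise_def space_pair_measure space_uniform_on)

lemma f_closed: "x \<in> X \<Longrightarrow> f x \<in> X"
  using measurable_space[OF f_measurable] by (simp add: space_uniform_on)

lemma funpow_measurable [measurable]: "(f ^^ k) \<in> measurable unif unif"
  by (induction k) simp_all

lemma nn_integral_noise:
  assumes [measurable]: "g \<in> borel_measurable (noise \<epsilon> X)"
  shows "(\<integral>\<^sup>+ \<omega>. g \<omega> \<partial>noise \<epsilon> X)
    = ennreal \<epsilon> * (\<integral>\<^sup>+ \<xi>. g (False, \<xi>) \<partial>unif) + ennreal (1 - \<epsilon>) * (\<integral>\<^sup>+ \<xi>. g (True, \<xi>) \<partial>unif)"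
proof -
  have "(\<integral>\<^sup>+ \<omega>. g \<omega> \<partial>noise \<epsilon> X)
      = (\<integral>\<^sup>+ \<eta>. \<integral>\<^sup>+ \<xi>. g (\<eta>, \<xi>) \<partial>unif \<partial>measure_pmf (bernoulli_pmf (1 - \<epsilon>)))"
    using assms unfolding noise_def by (rule U.nn_integral_fst[symmetric])
  then show ?thesis using eps by (simp add: mult.commute add.commute)
qed

lemma perturbed_simps [simp]: "perturbed f (True, \<xi>) x = f x" "perturbed f (False, \<xi>) x = \<xi>"
  by (simp_all add: perturbed_def)

lemma perturbed_measurable [measurable]:
  "(\<lambda>(\<omega>, x). perturbed f \<omega> x) \<in> measurable (noise \<epsilon> X \<Otimes>\<^sub>M unif) unif"
proof -
  have [measurable]: "fst \<in> measurable (noise \<epsilon> X) (count_space UNIV)"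
    "snd \<in> measurable (noise \<epsilon> X) unif"
    unfolding noise_def
    using measurable_fst[of "measure_pmf (bernoulli_pmf (1 - \<epsilon>))" unif]
    by (simp_all cong: measurable_cong_sets)
  have eq: "(\<lambda>(\<omega>, x). perturbed f \<omega> x) = (\<lambda>p. if fst (fst p) then f (snd p) else snd (fst p))"
    by (auto simp: fun_eq_iff perturbed_def)
  show ?thesis unfolding eq by measurable
qed

lemma random_orbit_measurable [measurable]:
  "(\<lambda>(x, w). random_orbit f w n x) \<in> measurable (unif \<Otimes>\<^sub>M noise_seq) unif"
proof (induction n)
  case (Suc n)
  have [measurable]: "(\<lambda>p. random_orbit f (snd p) n (fst p)) \<in> measurable (unif \<Otimes>\<^sub>M noise_seq) unif"
    using Suc by (simp add: case_prod_beta')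
  have "(\<lambda>p. (\<lambda>(\<omega>, x). perturbed f \<omega> x) (snd p n, random_orbit f (snd p) n (fst p)))
      \<in> measurable (unif \<Otimes>\<^sub>M noise_seq) unif"
    by measurable
  then show ?case by (simp add: case_prod_beta')
qed simp

lemma shift_measurable [measurable]:
  "(\<lambda>w k. w (k + s)) \<in> measurable noise_seq noise_seq"
  by (rule measurable_PiM_single') (auto simp: space_PiM PiE_iff)

lemma random_orbit_case_nat:
  "random_orbit f (case_nat \<omega> w) (Suc n) x = random_orbit f w n (perturbed f \<omega> x)"
  by (induction n) auto

lemma random_orbit_add:
  "random_orbit f w (i + s) x = random_orbit f (\<lambda>k. w (k + s)) i (random_orbit f w s x)"
  by (induction i) auto

text \<open>With \<open>h\<close> a function of the state, \<open>refreshed s h\<close> is the part of its mean at time \<open>s\<close> that comes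
  from the orbits that have been redrawn at least once; the index \<open>i\<close> is the time elapsed since the
  last redrawing. It does not depend on the starting point.\<close>

definition refreshed :: "nat \<Rightarrow> ('a \<Rightarrow> ennreal) \<Rightarrow> ennreal" where
  "refreshed s h = (\<Sum>i<s. ennreal (\<epsilon> * (1 - \<epsilon>) ^ i) * (\<integral>\<^sup>+ y. h ((f ^^ i) y) \<partial>unif))"

text \<open>The Markov property together with an explicit formula for the transition operator: either the
  map was applied \<open>s\<close> times, with probability \<open>(1 - \<epsilon>) ^ s\<close>, or the orbit has forgotten \<open>x\<close>.
  The induction splits off the first noise variable, so that the starting point varies.\<close>

lemma nn_integral_random_orbit:
  assumes H [measurable]: "H \<in> borel_measurable (unif \<Otimes>\<^sub>M noise_seq)" and "x \<in> X"
  defines "h \<equiv> \<lambda>y. \<integral>\<^sup>+ w. H (y, w) \<partial>noise_seq"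
  shows "(\<integral>\<^sup>+ w. H (random_orbit f w s x, \<lambda>k. w (k + s)) \<partial>noise_seq)
    = ennreal ((1 - \<epsilon>) ^ s) * h ((f ^^ s) x) + refreshed s h"
  using \<open>x \<in> X\<close>
proof (induction s arbitrary: x)
  case 0
  then show ?case by (simp add: refreshed_def h_def)
next
  case (Suc s)
  have h [measurable]: "h \<in> borel_measurable unif"
    unfolding h_def by measurable
  have ox: "(\<lambda>w. random_orbit f w n y) \<in> measurable noise_seq unif" if "y \<in> X" for n y
    using measurable_Pair2[OF random_orbit_measurable] that by (simp add: space_uniform_on)
  define G where "G w = H (random_orbit f w (Suc s) x, \<lambda>k. w (k + Suc s))" for w
  note ox[OF Suc.prems, of "Suc s", measurable]
  have G [measurable]: "G \<in> borel_measurable noise_seq" unfolding G_def by measurable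
  define q where "q y = ennreal ((1 - \<epsilon>) ^ s) * h ((f ^^ s) y) + refreshed s h" for y
  have q [measurable]: "q \<in> borel_measurable unif" unfolding q_def by measurable
  have "(\<integral>\<^sup>+ w. G w \<partial>noise_seq)
      = (\<integral>\<^sup>+ w. G w \<partial>distr (noise \<epsilon> X \<Otimes>\<^sub>M noise_seq) noise_seq (\<lambda>(\<omega>, w). case_nat \<omega> w))"
    by (simp add: W.PiM_iter)
  also have "\<dots> = (\<integral>\<^sup>+ p. G (case_prod case_nat p) \<partial>(noise \<epsilon> X \<Otimes>\<^sub>M noise_seq))"
    by (rule nn_integral_distr) measurable
  also have "\<dots> = (\<integral>\<^sup>+ \<omega>. \<integral>\<^sup>+ w. G (case_prod case_nat (\<omega>, w)) \<partial>noise_seq \<partial>noise \<epsilon> X)"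
    by (rule W.nn_integral_fst[symmetric]) measurable
  also have "\<dots> = (\<integral>\<^sup>+ \<omega>. q (perturbed f \<omega> x) \<partial>noise \<epsilon> X)"
  proof (rule nn_integral_cong)
    fix \<omega> assume "\<omega> \<in> space (noise \<epsilon> X)"
    then have "perturbed f \<omega> x \<in> X"
      using Suc.prems f_closed by (auto simp: space_noise perturbed_def)
    from Suc.IH[OF this]
    show "(\<integral>\<^sup>+ w. G (case_prod case_nat (\<omega>, w)) \<partial>noise_seq) = q (perturbed f \<omega> x)"
      by (simp add: G_def q_def random_orbit_case_nat del: random_orbit.simps)
  qed
  also have "\<dots> = ennreal \<epsilon> * (\<integral>\<^sup>+ \<xi>. q \<xi> \<partial>unif) + ennreal (1 - \<epsilon>) * q (f x)"
  proof -
    have "(\<lambda>\<omega>. perturbed f \<omega> x) \<in> measurable (noise \<epsilon> X) unif"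
      using measurable_Pair1[OF perturbed_measurable] Suc.prems by (simp add: space_uniform_on)
    then have "(\<lambda>\<omega>. q (perturbed f \<omega> x)) \<in> borel_measurable (noise \<epsilon> X)" by measurable
    from nn_integral_noise[OF this] show ?thesis by (simp add: U.emeasure_space_1)
  qed
  also have "(\<integral>\<^sup>+ \<xi>. q \<xi> \<partial>unif)
      = ennreal ((1 - \<epsilon>) ^ s) * (\<integral>\<^sup>+ \<xi>. h ((f ^^ s) \<xi>) \<partial>unif) + refreshed s h"
    by (simp add: q_def nn_integral_add nn_integral_cmult U.emeasure_space_1)
  also have "ennreal \<epsilon> * (ennreal ((1 - \<epsilon>) ^ s) * (\<integral>\<^sup>+ \<xi>. h ((f ^^ s) \<xi>) \<partial>unif) + refreshed s h)
      + ennreal (1 - \<epsilon>) * q (f x)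
    = ennreal ((1 - \<epsilon>) ^ Suc s) * h ((f ^^ Suc s) x)
      + (ennreal \<epsilon> * refreshed s h + ennreal (1 - \<epsilon>) * refreshed s h
        + ennreal (\<epsilon> * (1 - \<epsilon>) ^ s) * (\<integral>\<^sup>+ \<xi>. h ((f ^^ s) \<xi>) \<partial>unif))"
    using eps by (simp add: q_def ennreal_mult distrib_left funpow_swap1 ac_simps)
  also have "ennreal \<epsilon> * refreshed s h + ennreal (1 - \<epsilon>) * refreshed s h = refreshed s h"
    using eps by (simp flip: distrib_right ennreal_plus)
  also have "refreshed s h + ennreal (\<epsilon> * (1 - \<epsilon>) ^ s) * (\<integral>\<^sup>+ \<xi>. h ((f ^^ s) \<xi>) \<partial>unif)
      = refreshed (Suc s) h"
    by (simp add: refreshed_def)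
  finally show ?case unfolding G_def .
qed

end

section \<open>The stationary measure\<close>

locale stationary_random_map = random_map +
  fixes \<mu> :: "'a measure"
  assumes stationary: "stationary_acpm \<epsilon> X f \<mu>"
begin

lemma sets_mu [measurable_cong]: "sets \<mu> = sets unif"
  using stationary by (simp add: stationary_acpm_def)

lemma space_mu: "space \<mu> = X"
  using sets_eq_imp_space_eq[OF sets_mu] by (simp add: space_uniform_on)

sublocale mu: prob_space \<mu> using stationary by (simp add: stationary_acpm_def)

sublocale P: pair_prob_space \<mu> noise_seq ..

lemma null_sets_mu: "A \<in> null_sets unif \<Longrightarrow> A \<in> null_sets \<mu>"
  using stationary by (auto simp: stationary_acpm_def absolutely_continuous_def)

lemma nn_integral_stationary_step:
  assumes [measurable]: "g \<in> borel_measurable unif"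
  shows "(\<integral>\<^sup>+ x. g x \<partial>\<mu>)
    = ennreal \<epsilon> * (\<integral>\<^sup>+ x. g x \<partial>unif) + ennreal (1 - \<epsilon>) * (\<integral>\<^sup>+ x. g (f x) \<partial>\<mu>)"
proof -
  define T where "T p = perturbed f (snd p) (fst p)" for p :: "'a \<times> bool \<times> 'a"
  have T_eq: "T = (\<lambda>p. (\<lambda>(\<omega>, x). perturbed f \<omega> x) (snd p, fst p))"
    by (simp add: fun_eq_iff T_def)
  have T [measurable]: "T \<in> measurable (unif \<Otimes>\<^sub>M noise \<epsilon> X) unif"
    unfolding T_eq by measurable
  have "\<mu> = distr (\<mu> \<Otimes>\<^sub>M noise \<epsilon> X) \<mu> T"
  proof (rule measure_eqI)
    fix A assume A [measurable]: "A \<in> sets \<mu>"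
    have "emeasure (distr (\<mu> \<Otimes>\<^sub>M noise \<epsilon> X) \<mu> T) A
        = (\<integral>\<^sup>+ p. indicator A p \<partial>distr (\<mu> \<Otimes>\<^sub>M noise \<epsilon> X) \<mu> T)"
      by simp
    also have "\<dots> = (\<integral>\<^sup>+ p. indicator A (T p) \<partial>(\<mu> \<Otimes>\<^sub>M noise \<epsilon> X))"
      by (rule nn_integral_distr) measurable
    also have "\<dots> = (\<integral>\<^sup>+ x. \<integral>\<^sup>+ \<omega>. indicator A (T (x, \<omega>)) \<partial>noise \<epsilon> X \<partial>\<mu>)"
      by (rule N.nn_integral_fst[symmetric]) measurable
    finally show "emeasure \<mu> A = emeasure (distr (\<mu> \<Otimes>\<^sub>M noise \<epsilon> X) \<mu> T) A"
      using stationary A by (simp add: stationary_acpm_def T_def)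
  qed simp
  then have "(\<integral>\<^sup>+ x. g x \<partial>\<mu>) = (\<integral>\<^sup>+ x. g x \<partial>distr (\<mu> \<Otimes>\<^sub>M noise \<epsilon> X) \<mu> T)" by simp
  also have "\<dots> = (\<integral>\<^sup>+ p. g (T p) \<partial>(\<mu> \<Otimes>\<^sub>M noise \<epsilon> X))"
    by (rule nn_integral_distr) measurable
  also have "\<dots> = (\<integral>\<^sup>+ x. \<integral>\<^sup>+ \<omega>. g (T (x, \<omega>)) \<partial>noise \<epsilon> X \<partial>\<mu>)"
    by (rule N.nn_integral_fst[symmetric]) measurable
  also have "\<dots> = (\<integral>\<^sup>+ x. ennreal \<epsilon> * (\<integral>\<^sup>+ x. g x \<partial>unif) + ennreal (1 - \<epsilon>) * g (f x) \<partial>\<mu>)"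
  proof (rule nn_integral_cong)
    fix x assume "x \<in> space \<mu>"
    then have [measurable]: "(\<lambda>\<omega>. T (x, \<omega>)) \<in> measurable (noise \<epsilon> X) unif"
      using measurable_Pair1[OF perturbed_measurable] by (simp add: T_def space_mu space_uniform_on)
    have "(\<lambda>\<omega>. g (T (x, \<omega>))) \<in> borel_measurable (noise \<epsilon> X)" by measurable
    from nn_integral_noise[OF this]
    show "(\<integral>\<^sup>+ \<omega>. g (T (x, \<omega>)) \<partial>noise \<epsilon> X)
        = ennreal \<epsilon> * (\<integral>\<^sup>+ x. g x \<partial>unif) + ennreal (1 - \<epsilon>) * g (f x)"
      by (simp add: T_def U.emeasure_space_1)
  qed
  also have "\<dots> = ennreal \<epsilon> * (\<integral>\<^sup>+ x. g x \<partial>unif) + ennreal (1 - \<epsilon>) * (\<integral>\<^sup>+ x. g (f x) \<partial>\<mu>)"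
    by (simp add: nn_integral_add nn_integral_cmult mu.emeasure_space_1)
  finally show ?thesis .
qed

text \<open>Iterating stationarity expands \<open>\<mu>\<close> into images of the uniform measure; the remainder after
  \<open>s\<close> steps has weight \<open>(1 - \<epsilon>) ^ s\<close>. The same constant \<open>refreshed s g\<close> occurs here and in the
  law of the orbit, which is the source of the decorrelation estimates below.\<close>

lemma nn_integral_stationary:
  assumes [measurable]: "g \<in> borel_measurable unif"
  shows "(\<integral>\<^sup>+ x. g x \<partial>\<mu>)
    = ennreal ((1 - \<epsilon>) ^ s) * (\<integral>\<^sup>+ x. g ((f ^^ s) x) \<partial>\<mu>) + refreshed s g"
proof (induction s)
  case (Suc s)
  have "(\<lambda>x. g ((f ^^ s) x)) \<in> borel_measurable unif" by measurable
  from nn_integral_stationary_step[OF this] show ?case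
    using eps
    by (simp add: Suc refreshed_def distrib_left ennreal_mult funpow_swap1 ac_simps)
qed (simp add: refreshed_def)

lemma refreshed_le:
  assumes "g \<in> borel_measurable unif"
  shows "refreshed s g \<le> (\<integral>\<^sup>+ x. g x \<partial>\<mu>)"
  unfolding nn_integral_stationary[OF assms, of s] by simp

lemma sets_path_measure: "sets (path_measure \<epsilon> X \<mu>) = sets (unif \<Otimes>\<^sub>M noise_seq)"
  unfolding path_measure_def by (rule sets_pair_measure_cong[OF sets_mu refl])

lemma space_path_measure: "space (path_measure \<epsilon> X \<mu>) = X \<times> space noise_seq"
  by (simp add: path_measure_def space_pair_measure space_mu)

lemma prob_path_measure: "prob_space (path_measure \<epsilon> X \<mu>)"
  unfolding path_measure_def by (rule P.prob_space_axioms)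

definition path_prob :: "('a \<times> (nat \<Rightarrow> bool \<times> 'a)) set \<Rightarrow> 'a \<Rightarrow> ennreal" where
  "path_prob E y = (\<integral>\<^sup>+ w. indicator E (y, w) \<partial>noise_seq)"

lemma path_prob_measurable [measurable]:
  assumes [measurable]: "E \<in> sets (unif \<Otimes>\<^sub>M noise_seq)"
  shows "path_prob E \<in> borel_measurable unif"
  unfolding path_prob_def[abs_def] by measurable

definition later :: "nat \<Rightarrow> ('a \<times> (nat \<Rightarrow> bool \<times> 'a)) set \<Rightarrow> ('a \<times> (nat \<Rightarrow> bool \<times> 'a)) set" where
  "later s E = {(x, w) \<in> X \<times> space noise_seq. (random_orbit f w s x, \<lambda>k. w (k + s)) \<in> E}"

lemma emeasure_path_now_and_later:
  assumes A [measurable]: "A \<in> sets unif" and E [measurable]: "E \<in> sets (unif \<Otimes>\<^sub>M noise_seq)"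
  shows "A \<times> space noise_seq \<inter> later s E \<in> sets (unif \<Otimes>\<^sub>M noise_seq)"
    and "emeasure (path_measure \<epsilon> X \<mu>) (A \<times> space noise_seq \<inter> later s E)
    = ennreal ((1 - \<epsilon>) ^ s) * (\<integral>\<^sup>+ x. indicator A x * path_prob E ((f ^^ s) x) \<partial>\<mu>)
      + refreshed s (path_prob E) * emeasure \<mu> A"
proof -
  have [measurable]: "(\<lambda>p. random_orbit f (snd p) s (fst p)) \<in> measurable (unif \<Otimes>\<^sub>M noise_seq) unif"
    using random_orbit_measurable[of s] by (simp add: case_prod_beta')
  have "{p \<in> space (unif \<Otimes>\<^sub>M noise_seq). fst p \<in> A \<and>
      (random_orbit f (snd p) s (fst p), \<lambda>k. snd p (k + s)) \<in> E} \<in> sets (unif \<Otimes>\<^sub>M noise_seq)"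
    by measurable
  also have "{p \<in> space (unif \<Otimes>\<^sub>M noise_seq). fst p \<in> A \<and>
      (random_orbit f (snd p) s (fst p), \<lambda>k. snd p (k + s)) \<in> E} = A \<times> space noise_seq \<inter> later s E"
    using sets.sets_into_space[OF A]
    by (auto simp: later_def space_pair_measure space_uniform_on)
  finally show meas [measurable]: "A \<times> space noise_seq \<inter> later s E \<in> sets (unif \<Otimes>\<^sub>M noise_seq)" .
  then have "emeasure (path_measure \<epsilon> X \<mu>) (A \<times> space noise_seq \<inter> later s E)
      = (\<integral>\<^sup>+ p. indicator (A \<times> space noise_seq \<inter> later s E) p \<partial>(\<mu> \<Otimes>\<^sub>M noise_seq))"
    using meas sets_path_measure by (simp add: path_measure_def)
  also have "\<dots> = (\<integral>\<^sup>+ x. \<integral>\<^sup>+ w. indicator (A \<times> space noise_seq \<inter> later s E) (x, w) \<partial>noise_seq \<partial>\<mu>)"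
    by (rule W.nn_integral_fst[symmetric]) measurable
  also have "\<dots> = (\<integral>\<^sup>+ x. ennreal ((1 - \<epsilon>) ^ s) * (indicator A x * path_prob E ((f ^^ s) x))
      + refreshed s (path_prob E) * indicator A x \<partial>\<mu>)"
  proof (rule nn_integral_cong)
    fix x assume "x \<in> space \<mu>"
    then have x: "x \<in> X" by (simp add: space_mu)
    have "(\<integral>\<^sup>+ w. indicator (A \<times> space noise_seq \<inter> later s E) (x, w) \<partial>noise_seq)
        = (\<integral>\<^sup>+ w. indicator A x * indicator E (random_orbit f w s x, \<lambda>k. w (k + s)) \<partial>noise_seq)"
      using x by (intro nn_integral_cong) (auto simp: later_def indicator_def)
    also have "\<dots> = indicator A x * (\<integral>\<^sup>+ w. indicator E (random_orbit f w s x, \<lambda>k. w (k + s)) \<partial>noise_seq)"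
    proof -
      have [measurable]: "(\<lambda>w. random_orbit f w s x) \<in> measurable noise_seq unif"
        using measurable_Pair2[OF random_orbit_measurable] x by (simp add: space_uniform_on)
      show ?thesis by (rule nn_integral_cmult) measurable
    qed
    also have "(\<integral>\<^sup>+ w. indicator E (random_orbit f w s x, \<lambda>k. w (k + s)) \<partial>noise_seq)
        = ennreal ((1 - \<epsilon>) ^ s) * path_prob E ((f ^^ s) x) + refreshed s (path_prob E)"
      unfolding path_prob_def using x by (intro nn_integral_random_orbit) measurable
    finally show "(\<integral>\<^sup>+ w. indicator (A \<times> space noise_seq \<inter> later s E) (x, w) \<partial>noise_seq)
      = ennreal ((1 - \<epsilon>) ^ s) * (indicator A x * path_prob E ((f ^^ s) x)) + refreshed s (path_prob E) * indicator A x"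
      by (simp add: distrib_left ac_simps)
  qed
  also have "\<dots> = ennreal ((1 - \<epsilon>) ^ s) * (\<integral>\<^sup>+ x. indicator A x * path_prob E ((f ^^ s) x) \<partial>\<mu>)
      + refreshed s (path_prob E) * emeasure \<mu> A"
    by (simp add: nn_integral_add nn_integral_cmult)
  finally show "emeasure (path_measure \<epsilon> X \<mu>) (A \<times> space noise_seq \<inter> later s E)
    = ennreal ((1 - \<epsilon>) ^ s) * (\<integral>\<^sup>+ x. indicator A x * path_prob E ((f ^^ s) x) \<partial>\<mu>)
      + refreshed s (path_prob E) * emeasure \<mu> A" .
qed

text \<open>Joint probability and product of probabilities contain the same redrawn part
  \<open>refreshed s h * \<mu> A\<close>. What remains of each carries the factor \<open>(1 - \<epsilon>) ^ s\<close>, and the factors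
  that multiply it lie between 0 and 1.\<close>

lemma exponential_mixing:
  assumes A [measurable]: "A \<in> sets unif" and E [measurable]: "E \<in> sets (unif \<Otimes>\<^sub>M noise_seq)"
  shows "\<bar>measure (path_measure \<epsilon> X \<mu>) (A \<times> space noise_seq \<inter> later s E)
    - measure \<mu> A * measure (path_measure \<epsilon> X \<mu>) E\<bar> \<le> (1 - \<epsilon>) ^ s"
proof -
  define h :: "'a \<Rightarrow> ennreal" where "h = path_prob E"
  have h [measurable]: "h \<in> borel_measurable unif"
    unfolding h_def by measurable
  have "h y \<le> (\<integral>\<^sup>+ w. 1 \<partial>noise_seq)" for y
    unfolding h_def path_prob_def by (intro nn_integral_mono) (simp add: indicator_def)
  then have h1: "h y \<le> 1" for y by (simp add: W.emeasure_space_1)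
  let ?I = "\<lambda>A. \<integral>\<^sup>+ x. indicator A x * h ((f ^^ s) x) \<partial>\<mu>"
  have I1: "?I A \<le> 1" for A
  proof -
    have "indicator A x * h ((f ^^ s) x) \<le> 1" for x using h1 by (simp add: indicator_def)
    then have "?I A \<le> (\<integral>\<^sup>+ x. 1 \<partial>\<mu>)" by (intro nn_integral_mono)
    then show ?thesis by (simp add: mu.emeasure_space_1)
  qed
  interpret PM: prob_space "path_measure \<epsilon> X \<mu>" by (rule prob_path_measure)
  have "(\<integral>\<^sup>+ x. h x \<partial>\<mu>) \<le> (\<integral>\<^sup>+ x. 1 \<partial>\<mu>)" using h1 by (intro nn_integral_mono)
  then have r1: "refreshed s h \<le> 1"
    using refreshed_le[OF h, of s] by (simp add: mu.emeasure_space_1)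
  (* passage to real numbers, where the common part can be subtracted *)
  define q a i1 i2 c where "q = (1 - \<epsilon>) ^ s" and "a = enn2real (refreshed s h)"
    and "i1 = enn2real (?I A)" and "i2 = enn2real (?I X)" and "c = measure \<mu> A"
  have a: "refreshed s h = ennreal a" and i1: "?I A = ennreal i1" and i2: "?I X = ennreal i2"
    using r1 I1[of A] I1[of X] by (auto simp: a_def i1_def i2_def intro!: ennreal_enn2real[symmetric]
        elim: le_less_trans)
  have c: "emeasure \<mu> A = ennreal c" by (simp add: c_def mu.emeasure_eq_measure)
  have nn: "0 \<le> q" "0 \<le> a" "0 \<le> i1" "0 \<le> i2" "0 \<le> c" "c \<le> 1"
    using eps by (auto simp: q_def a_def i1_def i2_def c_def)
  have le1: "i1 \<le> 1" "i2 \<le> 1" using I1[of A] I1[of X] by (simp_all add: i1 i2)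
  have "emeasure (path_measure \<epsilon> X \<mu>) (A \<times> space noise_seq \<inter> later s E) = ennreal (q * i1 + a * c)"
    using emeasure_path_now_and_later(2)[OF A E, of s] nn
    unfolding h_def[symmetric] by (simp add: a i1 c q_def ennreal_mult)
  then have P1: "measure (path_measure \<epsilon> X \<mu>) (A \<times> space noise_seq \<inter> later s E) = q * i1 + a * c"
    using nn by (simp add: measure_def del: ennreal_plus)
  have "emeasure (path_measure \<epsilon> X \<mu>) E = (\<integral>\<^sup>+ p. indicator E p \<partial>(\<mu> \<Otimes>\<^sub>M noise_seq))"
    using E sets_path_measure by (simp add: path_measure_def)
  also have "\<dots> = (\<integral>\<^sup>+ x. h x \<partial>\<mu>)"
    unfolding h_def path_prob_def by (rule W.nn_integral_fst[symmetric]) measurable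
  also have "\<dots> = ennreal q * (\<integral>\<^sup>+ x. h ((f ^^ s) x) \<partial>\<mu>) + refreshed s h"
    unfolding q_def by (rule nn_integral_stationary[OF h])
  also have "(\<integral>\<^sup>+ x. h ((f ^^ s) x) \<partial>\<mu>) = ?I X"
    by (intro nn_integral_cong) (simp add: space_mu)
  finally have "emeasure (path_measure \<epsilon> X \<mu>) E = ennreal (q * i2 + a)"
    using nn by (simp add: a i2 ennreal_mult)
  then have P2: "measure (path_measure \<epsilon> X \<mu>) E = q * i2 + a"
    using nn by (simp add: measure_def del: ennreal_plus)
  have "0 \<le> c * i2" "c * i2 \<le> 1" using nn le1 by (auto intro: mult_le_one)
  then have "\<bar>i1 - c * i2\<bar> \<le> 1" using nn le1 by linarith
  then have "q * \<bar>i1 - c * i2\<bar> \<le> q * 1" using nn by (intro mult_left_mono)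
  moreover have "(q * i1 + a * c) - c * (q * i2 + a) = q * (i1 - c * i2)"
    by (simp add: algebra_simps)
  ultimately show ?thesis
    unfolding P1 P2 c_def[symmetric] q_def[symmetric] using nn by (simp add: abs_mult)
qed

text \<open>Without deterministic returns only redrawn orbits can be back in \<open>A\<close>, and by stationarity
  their share of \<open>A\<close> is at most \<open>\<mu> A\<close>.\<close>

lemma return_probability_le:
  assumes A [measurable]: "A \<in> sets unif" and null: "A \<inter> (f ^^ j) -` A \<in> null_sets \<mu>"
  shows "measure (path_measure \<epsilon> X \<mu>)
    (A \<times> space noise_seq \<inter> later j (A \<times> space noise_seq)) \<le> (measure \<mu> A)\<^sup>2"
proof -
  have E: "A \<times> space noise_seq \<in> sets (unif \<Otimes>\<^sub>M noise_seq)" by measurable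
  define h where "h = path_prob (A \<times> space noise_seq)"
  have h: "h = indicator A"
  proof
    fix y
    have "h y = (\<integral>\<^sup>+ w. indicator A y \<partial>noise_seq)"
      unfolding h_def path_prob_def by (intro nn_integral_cong) (auto simp: indicator_def)
    then show "h y = indicator A y" by (simp add: W.emeasure_space_1)
  qed
  have "(\<integral>\<^sup>+ x. indicator A x * h ((f ^^ j) x) \<partial>\<mu>)
      = (\<integral>\<^sup>+ x. indicator (A \<inter> (f ^^ j) -` A) x \<partial>\<mu>)"
    unfolding h by (intro nn_integral_cong) (auto simp: indicator_def)
  also have "\<dots> = 0" using null by (subst nn_integral_indicator) auto
  finally have "emeasure (path_measure \<epsilon> X \<mu>) (A \<times> space noise_seq \<inter> later j (A \<times> space noise_seq))
      = refreshed j h * emeasure \<mu> A"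
    using emeasure_path_now_and_later(2)[OF A E, of j] unfolding h_def[symmetric] by simp
  also have "\<dots> \<le> emeasure \<mu> A * emeasure \<mu> A"
    using refreshed_le[of h j] by (intro mult_right_mono) (simp_all add: h)
  also have "\<dots> = ennreal ((measure \<mu> A)\<^sup>2)"
    by (simp add: mu.emeasure_eq_measure power2_eq_square ennreal_mult)
  finally show ?thesis by (simp add: measure_def enn2real_leI)
qed

end

context random_map
begin

lemma null_sets_funpow_vimage:
  assumes "nonsingular unif f" "A \<in> null_sets unif"
  shows "(f ^^ i) -` A \<inter> X \<in> null_sets unif"
proof (induction i)
  case 0
  have "A \<inter> X = A" using null_setsD2[OF assms(2)] sets.sets_into_space by (force simp: space_uniform_on)
  then show ?case using assms(2) by simp
next
  case (Suc i)
  have "(f ^^ Suc i) -` A \<inter> X = f -` ((f ^^ i) -` A \<inter> X) \<inter> X"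
    using f_closed by (auto simp: funpow_swap1)
  moreover have "f -` ((f ^^ i) -` A \<inter> X) \<inter> X \<in> null_sets unif"
    using assms(1) Suc unfolding nonsingular_def space_uniform_on by blast
  ultimately show ?case by metis
qed

end

section \<open>Exceedances of the observable\<close>

lemma obs_process_exceeds_iff:
  assumes "is_norm \<nu>"
  shows "obs_process \<nu> f z j (x, w) > ereal u \<longleftrightarrow> random_orbit f w j x \<in> norm_ball \<nu> z (exp (- u))"
proof (cases "\<nu> (random_orbit f w j x - z) = 0")
  case True
  then show ?thesis by (simp add: obs_process_def norm_ball_def)
next
  case False
  then have pos: "\<nu> (random_orbit f w j x - z) > 0"
    using is_norm_nonneg[OF assms, of "random_orbit f w j x - z"] by linarith
  have "u < - ln r \<longleftrightarrow> r < exp (- u)" if "r > 0" for r :: real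
    using ln_less_cancel_iff[of r "exp (- u)"] that by auto
  then show ?thesis using pos by (simp add: obs_process_def norm_ball_def Let_def)
qed

text \<open>The choice \<open>k = \<lfloor>sqrt (n / (t + 1))\<rfloor>\<close> works because \<open>n / t\<close> tends to
  infinity: its square root leaves room both for \<open>k \<rightarrow> \<infinity>\<close> and for \<open>k t / n \<le> sqrt (t / n) \<rightarrow> 0\<close>.\<close>

lemma block_count_exists:
  fixes t :: "nat \<Rightarrow> nat"
  assumes "(\<lambda>n. real (t n)) \<in> o(\<lambda>n. real n)"
  obtains k :: "nat \<Rightarrow> nat" where "filterlim k at_top sequentially"
    "(\<lambda>n. real (k n * t n)) \<in> o(\<lambda>n. real n)"
proof -
  have t0: "(\<lambda>n. real (t n) / real n) \<longlonglongrightarrow> 0"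
    using smalloD_tendsto[OF assms] .
  have "(\<lambda>n. real (t n) / real n + 1 / real n) \<longlonglongrightarrow> 0 + 0"
    by (intro tendsto_add t0 lim_1_over_n)
  then have "(\<lambda>n. (real (t n) + 1) / real n) \<longlonglongrightarrow> 0" by (simp add: add_divide_distrib)
  moreover have "\<forall>\<^sub>F n in sequentially. 0 < (real (t n) + 1) / real n"
    using eventually_gt_at_top[of 0] by eventually_elim (simp add: add_nonneg_pos)
  ultimately have "filterlim (\<lambda>n. inverse ((real (t n) + 1) / real n)) at_top sequentially"
    by (rule filterlim_inverse_at_top)
  then have "filterlim (\<lambda>n. sqrt (real n / (real (t n) + 1))) at_top sequentially"
    using filterlim_compose[OF sqrt_at_top] by simp
  then have lim: "filterlim (\<lambda>n. nat \<lfloor>sqrt (real n / (real (t n) + 1))\<rfloor>) at_top sequentially"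
    by (intro filterlim_compose[OF filterlim_nat_sequentially] filterlim_compose[OF filterlim_floor_sequentially])
  have sq: "(\<lambda>n. sqrt (real (t n) / real n)) \<longlonglongrightarrow> 0"
    using tendsto_real_sqrt[OF t0] by simp
  have "(\<lambda>n. real (nat \<lfloor>sqrt (real n / (real (t n) + 1))\<rfloor> * t n) / real n) \<longlonglongrightarrow> 0"
  proof (rule tendsto_sandwich[OF _ _ tendsto_const sq])
    show "\<forall>\<^sub>F n in sequentially. real (nat \<lfloor>sqrt (real n / (real (t n) + 1))\<rfloor> * t n) / real n
        \<le> sqrt (real (t n) / real n)"
    proof (intro always_eventually allI)
      fix n
      show "real (nat \<lfloor>sqrt (real n / (real (t n) + 1))\<rfloor> * t n) / real n \<le> sqrt (real (t n) / real n)"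
      proof (cases "n = 0")
        case False
        then have n: "real n > 0" by simp
        have "real (nat \<lfloor>sqrt (real n / (real (t n) + 1))\<rfloor> * t n) / real n
            \<le> sqrt (real n / (real (t n) + 1)) * (real (t n) / real n)"
          by (simp add: divide_right_mono mult_right_mono)
        also have "\<dots> \<le> sqrt (real (t n) / real n)"
        proof (rule real_le_rsqrt)
          have nonneg: "0 \<le> real n / (real (t n) + 1)" by simp
          have "(sqrt (real n / (real (t n) + 1)) * (real (t n) / real n))\<^sup>2
              = (real n / (real (t n) + 1)) * (real (t n) / real n)\<^sup>2"
            by (simp only: power_mult_distrib real_sqrt_pow2[OF nonneg])
          also have "\<dots> = (real (t n) / (real (t n) + 1)) * (real (t n) / real n)"
            using n by (simp add: power2_eq_square)
          also have "\<dots> \<le> 1 * (real (t n) / real n)"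
            by (intro mult_right_mono) auto
          finally show "(sqrt (real n / (real (t n) + 1)) * (real (t n) / real n))\<^sup>2 \<le> real (t n) / real n"
            by simp
        qed
        finally show ?thesis .
      qed simp
    qed
  qed (auto intro!: always_eventually)
  moreover have "\<forall>\<^sub>F n in sequentially. real n \<noteq> 0"
    using eventually_gt_at_top[of 0] by eventually_elim simp
  ultimately show ?thesis using that[OF lim] by (simp add: smalloI_tendsto)
qed

context stationary_random_map
begin

context
  fixes \<nu> :: "'a \<Rightarrow> real" and z :: 'a
  assumes \<nu>: "is_norm \<nu>"
begin

definition target :: "real \<Rightarrow> 'a set" where
  "target u = X \<inter> norm_ball \<nu> z (exp (- u))"

definition avoiding :: "nat \<Rightarrow> real \<Rightarrow> ('a \<times> (nat \<Rightarrow> bool \<times> 'a)) set" where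
  "avoiding l u = {(x, w) \<in> X \<times> space noise_seq. \<forall>i<l. random_orbit f w i x \<notin> target u}"

lemma random_orbit_in: "x \<in> X \<Longrightarrow> w \<in> space noise_seq \<Longrightarrow> random_orbit f w i x \<in> X"
  using measurable_space[OF random_orbit_measurable[of i], of "(x, w)"]
  by (simp add: space_pair_measure space_uniform_on)

lemma shift_in: "w \<in> space noise_seq \<Longrightarrow> (\<lambda>k. w (k + s)) \<in> space noise_seq"
  using measurable_space[OF shift_measurable] by blast

lemma target_sets [measurable]: "target u \<in> sets unif"
proof -
  have "norm_ball \<nu> z (exp (- u)) \<in> sets (normalized_lebesgue X)"
    using open_norm_ball[OF \<nu>] by (simp add: normalized_lebesgue_def borel_open)
  then show ?thesis by (auto simp: uniform_on_def sets_restrict_space target_def)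
qed

lemma avoiding_sets [measurable]: "avoiding l u \<in> sets (unif \<Otimes>\<^sub>M noise_seq)"
proof -
  have [measurable]: "(\<lambda>p. random_orbit f (snd p) i (fst p)) \<in> measurable (unif \<Otimes>\<^sub>M noise_seq) unif" for i
    using random_orbit_measurable[of i] by (simp add: case_prod_beta')
  have "avoiding l u = {p \<in> space (unif \<Otimes>\<^sub>M noise_seq).
      \<forall>i<l. random_orbit f (snd p) i (fst p) \<notin> target u}"
    by (auto simp: avoiding_def space_pair_measure space_uniform_on)
  also have "\<dots> \<in> sets (unif \<Otimes>\<^sub>M noise_seq)"
    by measurable
  finally show ?thesis .
qed

lemma exceeds_iff_target:
  assumes "x \<in> X" "w \<in> space noise_seq"
  shows "ereal u < obs_process \<nu> f z j (x, w) \<longleftrightarrow> random_orbit f w j x \<in> target u"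
  using obs_process_exceeds_iff[OF \<nu>, of u f z j x w] random_orbit_in[OF assms]
  by (auto simp: target_def)

lemma exceedance_event:
  "{\<omega> \<in> space (path_measure \<epsilon> X \<mu>). ereal u < obs_process \<nu> f z 0 \<omega>} = target u \<times> space noise_seq"
proof -
  have "{\<omega> \<in> space (path_measure \<epsilon> X \<mu>). ereal u < obs_process \<nu> f z 0 \<omega>}
      = {(x, w) \<in> X \<times> space noise_seq. x \<in> target u}"
    by (auto simp: space_path_measure exceeds_iff_target)
  then show ?thesis by (auto simp: target_def)
qed

lemma return_event:
  "{\<omega> \<in> space (path_measure \<epsilon> X \<mu>). ereal u < obs_process \<nu> f z 0 \<omega> \<and> ereal u < obs_process \<nu> f z j \<omega>}
    = target u \<times> space noise_seq \<inter> later j (target u \<times> space noise_seq)"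
  using shift_in by (auto simp: space_path_measure exceeds_iff_target later_def target_def)

lemma Max_le_iff_avoiding:
  assumes "x \<in> X" "w \<in> space noise_seq" "l \<ge> 1"
  shows "Max ((\<lambda>i. obs_process \<nu> f z i (x, w)) ` {s..<s + l}) \<le> ereal u
    \<longleftrightarrow> (random_orbit f w s x, \<lambda>k. w (k + s)) \<in> avoiding l u"
proof -
  have "Max ((\<lambda>i. obs_process \<nu> f z i (x, w)) ` {s..<s + l}) \<le> ereal u
      \<longleftrightarrow> (\<forall>i\<in>{s..<s + l}. \<not> ereal u < obs_process \<nu> f z i (x, w))"
    using assms(3) by (subst Max_le_iff) (auto simp: not_less)
  also have "\<dots> \<longleftrightarrow> (\<forall>i\<in>{s..<s + l}. random_orbit f w i x \<notin> target u)"
    using exceeds_iff_target[OF assms(1,2)] by blast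
  also have "\<dots> \<longleftrightarrow> (\<forall>i<l. random_orbit f w (i + s) x \<notin> target u)"
  proof safe
    fix i assume H: "\<forall>i<l. random_orbit f w (i + s) x \<notin> target u" "i \<in> {s..<s + l}"
      "random_orbit f w i x \<in> target u"
    then have "i - s < l" "i - s + s = i" by (simp_all, linarith)
    then show False using H by metis
  qed auto
  also have "\<dots> \<longleftrightarrow> (random_orbit f w s x, \<lambda>k. w (k + s)) \<in> avoiding l u"
    using assms by (simp add: avoiding_def random_orbit_add random_orbit_in shift_in)
  finally show ?thesis .
qed

lemma maximum_event:
  assumes "l \<ge> 1"
  shows "{\<omega> \<in> space (path_measure \<epsilon> X \<mu>). ereal u < obs_process \<nu> f z 0 \<omega> \<and>
      Max ((\<lambda>i. obs_process \<nu> f z i \<omega>) ` {s..<s + l}) \<le> ereal u}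
    = target u \<times> space noise_seq \<inter> later s (avoiding l u)"
    and "{\<omega> \<in> space (path_measure \<epsilon> X \<mu>).
      Max ((\<lambda>i. obs_process \<nu> f z i \<omega>) ` {0..<l}) \<le> ereal u} = avoiding l u"
proof -
  have "target u \<subseteq> X" by (auto simp: target_def)
  then show "{\<omega> \<in> space (path_measure \<epsilon> X \<mu>). ereal u < obs_process \<nu> f z 0 \<omega> \<and>
      Max ((\<lambda>i. obs_process \<nu> f z i \<omega>) ` {s..<s + l}) \<le> ereal u}
    = target u \<times> space noise_seq \<inter> later s (avoiding l u)"
    using assms by (auto simp: space_path_measure exceeds_iff_target Max_le_iff_avoiding later_def
        simp del: Max_le_iff)
  show "{\<omega> \<in> space (path_measure \<epsilon> X \<mu>).
      Max ((\<lambda>i. obs_process \<nu> f z i \<omega>) ` {0..<l}) \<le> ereal u} = avoiding l u"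
    using Max_le_iff_avoiding[of _ _ l 0 u] assms
    by (auto simp: space_path_measure avoiding_def simp del: Max_le_iff)
qed

lemma measure_target_cylinder:
  "measure (path_measure \<epsilon> X \<mu>) (target u \<times> space noise_seq) = measure \<mu> (target u)"
proof -
  have "target u \<in> sets \<mu>" by (simp add: sets_mu)
  then show ?thesis
    unfolding path_measure_def measure_def
    by (subst W.emeasure_pair_measure_Times) (auto simp: W.emeasure_space_1)
qed

text \<open>The mixing rate \<open>(1 - \<epsilon>) ^ s\<close> is exponential, so a gap of larger order than \<open>ln n\<close> and of smaller
  order than \<open>n\<close> is admissible, for example \<open>sqrt n\<close>.\<close>

lemma D2_seq_obs_process:
  "D2_seq (path_measure \<epsilon> X \<mu>) (obs_process \<nu> f z) u (\<lambda>n. nat \<lfloor>sqrt n\<rfloor>)"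
  unfolding D2_seq_def
proof (intro exI[of _ "\<lambda>n s. (1 - \<epsilon>) ^ s"] conjI allI impI)
  fix l s n :: nat assume l: "l \<ge> 1"
  show "\<bar>\<P>(\<omega> in path_measure \<epsilon> X \<mu>. ereal (u n) < obs_process \<nu> f z 0 \<omega> \<and>
          Max ((\<lambda>i. obs_process \<nu> f z i \<omega>) ` {s..<s + l}) \<le> ereal (u n))
        - \<P>(\<omega> in path_measure \<epsilon> X \<mu>. ereal (u n) < obs_process \<nu> f z 0 \<omega>)
          * \<P>(\<omega> in path_measure \<epsilon> X \<mu>. Max ((\<lambda>i. obs_process \<nu> f z i \<omega>) ` {0..<l}) \<le> ereal (u n))\<bar>
      \<le> (1 - \<epsilon>) ^ s"
    unfolding maximum_event[OF l] exceedance_event measure_target_cylinder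
    by (rule exponential_mixing) measurable
next
  fix n :: nat
  show "antimono (\<lambda>s. (1 - \<epsilon>) ^ s)"
    using eps by (intro antimonoI power_decreasing) auto
next
  (* the exponent sqrt n - 1 absorbs the rounding of sqrt n *)
  have lim: "(\<lambda>n. real n * (1 - \<epsilon>) powr (sqrt (real n) - 1)) \<longlonglongrightarrow> 0"
    using eps by real_asymp
  show "(\<lambda>n. real n * (1 - \<epsilon>) ^ nat \<lfloor>sqrt (real n)\<rfloor>) \<longlonglongrightarrow> 0"
  proof (rule tendsto_sandwich[OF _ _ tendsto_const lim])
    show "\<forall>\<^sub>F n in sequentially. real n * (1 - \<epsilon>) ^ nat \<lfloor>sqrt (real n)\<rfloor>
        \<le> real n * (1 - \<epsilon>) powr (sqrt (real n) - 1)"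
    proof (intro always_eventually allI mult_left_mono)
      fix n :: nat
      have "sqrt (real n) - 1 \<le> real (nat \<lfloor>sqrt (real n)\<rfloor>)"
        using real_sqrt_ge_zero[of "real n"] by linarith
      moreover have "(1 - \<epsilon>) ^ m = (1 - \<epsilon>) powr real m" for m
        using eps by (simp add: powr_realpow)
      ultimately show "(1 - \<epsilon>) ^ nat \<lfloor>sqrt (real n)\<rfloor> \<le> (1 - \<epsilon>) powr (sqrt (real n) - 1)"
        using eps by (simp only:) (intro powr_mono', auto)
    qed simp
  qed (use eps in auto)
next
  show "(\<lambda>n. real (nat \<lfloor>sqrt (real n)\<rfloor>)) \<in> o(\<lambda>n. real n)"
  proof (rule landau_o.big_small_trans)
    show "(\<lambda>n. real (nat \<lfloor>sqrt (real n)\<rfloor>)) \<in> O(\<lambda>n. sqrt (real n))"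
      by (rule bigoI[of _ 1]) (auto intro!: always_eventually)
    show "(\<lambda>n. sqrt (real n)) \<in> o(\<lambda>n. real n)" by real_asymp
  qed
qed

text \<open>Each of the \<open>n div k\<close> return probabilities is at most the square of \<open>\<mu> (target u)\<close>, which is
  \<open>O(1 / n)\<close>; so \<open>n\<close> times their sum is \<open>O(1 / k)\<close>.\<close>

lemma cond_D'_obs_process:
  assumes returns: "\<forall>\<^sub>F n in sequentially. \<forall>j\<ge>1. target (u n) \<inter> (f ^^ j) -` target (u n) \<in> null_sets \<mu>"
    and bound: "\<forall>\<^sub>F n in sequentially. real n * measure \<mu> (target (u n)) \<le> C"
  shows "cond_D' (path_measure \<epsilon> X \<mu>) (obs_process \<nu> f z) u"
  unfolding cond_D'_def
proof (intro conjI allI impI)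
  show "\<exists>t. D2_seq (path_measure \<epsilon> X \<mu>) (obs_process \<nu> f z) u t"
    using D2_seq_obs_process by blast
next
  fix t :: "nat \<Rightarrow> nat"
  assume "D2_seq (path_measure \<epsilon> X \<mu>) (obs_process \<nu> f z) u t"
  then have t: "(\<lambda>n. real (t n)) \<in> o(\<lambda>n. real n)" by (auto simp: D2_seq_def)
  obtain k :: "nat \<Rightarrow> nat" where k: "filterlim k at_top sequentially"
    "(\<lambda>n. real (k n * t n)) \<in> o(\<lambda>n. real n)"
    using block_count_exists[OF t] by blast
  have C_lim: "(\<lambda>n. C\<^sup>2 / real (k n)) \<longlonglongrightarrow> 0"
    by (rule tendsto_divide_0[OF tendsto_const])
       (rule filterlim_at_top_imp_at_infinity[OF filterlim_compose[OF filterlim_real_sequentially k(1)]])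
  let ?p = "\<lambda>n j. \<P>(\<omega> in path_measure \<epsilon> X \<mu>. ereal (u n) < obs_process \<nu> f z 0 \<omega> \<and>
    ereal (u n) < obs_process \<nu> f z j \<omega>)"
  have "(\<lambda>n. real n * (\<Sum>j=1..n div k n. ?p n j)) \<longlonglongrightarrow> 0"
  proof (rule tendsto_sandwich[OF _ _ tendsto_const C_lim])
    show "\<forall>\<^sub>F n in sequentially. real n * (\<Sum>j=1..n div k n. ?p n j) \<le> C\<^sup>2 / real (k n)"
      using returns bound
    proof eventually_elim
      case (elim n)
      let ?m = "measure \<mu> (target (u n))"
      have "?p n j \<le> ?m\<^sup>2" if "j \<ge> 1" for j
        unfolding return_event using elim(1) that by (intro return_probability_le) auto
      then have "(\<Sum>j=1..n div k n. ?p n j) \<le> (\<Sum>j=1..n div k n. ?m\<^sup>2)"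
        by (intro sum_mono) auto
      also have "\<dots> = real (n div k n) * ?m\<^sup>2" by simp
      also have "\<dots> \<le> real n / real (k n) * ?m\<^sup>2"
        by (intro mult_right_mono of_nat_div_le_of_nat) auto
      finally have "real n * (\<Sum>j=1..n div k n. ?p n j) \<le> real n * (real n / real (k n) * ?m\<^sup>2)"
        by (intro mult_left_mono) auto
      also have "\<dots> = (real n * ?m)\<^sup>2 / real (k n)" by (simp add: power2_eq_square)
      also have "\<dots> \<le> C\<^sup>2 / real (k n)"
        using elim(2) by (intro divide_right_mono power_mono) auto
      finally show ?case .
    qed
  qed (auto intro!: always_eventually mult_nonneg_nonneg sum_nonneg)
  with k show "\<exists>k. filterlim k at_top sequentially \<and> (\<lambda>n. real (k n * t n)) \<in> o(\<lambda>n. real n) \<and>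
      (\<lambda>n. real n * (\<Sum>j=1..n div k n. ?p n j)) \<longlonglongrightarrow> 0"
    by blast
qed

end

text \<open>If almost no point reaches \<open>A\<close> in \<open>q\<close> steps of \<open>f\<close>, the expansion of the stationary measure
  stops and bounds \<open>\<mu> A\<close> by finitely many uniform volumes of preimages.\<close>

lemma measure_stationary_le:
  assumes A [measurable]: "A \<in> sets unif"
    and null: "(f ^^ q) -` A \<inter> X \<in> null_sets \<mu>"
    and le: "\<And>i. i < q \<Longrightarrow> emeasure unif ((f ^^ i) -` A \<inter> X) \<le> ennreal (c i)"
    and nonneg: "\<And>i. i < q \<Longrightarrow> 0 \<le> c i"
  shows "measure \<mu> A \<le> (\<Sum>i<q. c i)"
proof -
  have ind: "(\<integral>\<^sup>+ x. indicator A ((f ^^ i) x) \<partial>M) = emeasure M ((f ^^ i) -` A \<inter> X)"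
    if [measurable_cong]: "sets M = sets unif" for M i
  proof -
    have sp: "space M = X" using sets_eq_imp_space_eq[OF that] by (simp add: space_uniform_on)
    have "(f ^^ i) -` A \<inter> space M \<in> sets M" by (rule measurable_sets[of _ M unif]) measurable
    then show ?thesis
      unfolding sp by (subst nn_integral_indicator[symmetric])
         (auto simp: sp indicator_def simp del: nn_integral_indicator intro!: nn_integral_cong)
  qed
  have "emeasure \<mu> A = ennreal ((1 - \<epsilon>) ^ q) * emeasure \<mu> ((f ^^ q) -` A \<inter> X) + refreshed q (indicator A)"
    using nn_integral_stationary[of "indicator A" q] ind[OF sets_mu, of q] A
    by (simp add: sets_mu)
  also have "emeasure \<mu> ((f ^^ q) -` A \<inter> X) = 0" using null by auto
  also have "refreshed q (indicator A) = (\<Sum>i<q. ennreal (\<epsilon> * (1 - \<epsilon>) ^ i) * emeasure unif ((f ^^ i) -` A \<inter> X))"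
    by (simp add: refreshed_def ind)
  also have "\<dots> \<le> (\<Sum>i<q. ennreal 1 * ennreal (c i))"
    using eps le by (intro sum_mono mult_mono ennreal_leI mult_le_one power_le_one) auto
  finally have "emeasure \<mu> A \<le> ennreal (\<Sum>i<q. c i)"
    using sum_ennreal[of "{..<q}" c] nonneg by simp
  then show ?thesis
    using nonneg sum_nonneg[of "{..<q}" c] by (simp add: mu.emeasure_eq_measure)
qed

end

section \<open>Shrinking balls around a point with finitely many preimages\<close>

lemma emeasure_uniform_on_le:
  fixes X :: "'a::euclidean_space set"
  assumes "X \<in> sets lebesgue" "A \<subseteq> X" "A \<subseteq> B" "B \<in> sets lebesgue"
  shows "emeasure (uniform_on X) A \<le> emeasure (normalized_lebesgue X) B"
proof -
  have "emeasure lebesgue A \<le> emeasure lebesgue B" using assms(3,4) by (rule emeasure_mono)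
  then show ?thesis
    unfolding emeasure_uniform_on[OF assms(1,2)] normalized_lebesgue_def emeasure_scale_measure
    by (rule mult_left_mono) simp
qed

lemma Jac_nonneg: "0 \<le> Jac X f k z"
  by (simp add: Jac_def prod_nonneg)

lemma weighted_Jac_sum_pos:
  assumes "0 < \<epsilon>" "\<epsilon> < 1"
  shows "0 < \<epsilon> * (\<Sum>k=0..p. (1 - \<epsilon>) ^ k * Jac X f k z)"
proof -
  have "(1 - \<epsilon>) ^ 0 * Jac X f 0 z \<le> (\<Sum>k=0..p. (1 - \<epsilon>) ^ k * Jac X f k z)"
    using assms by (intro member_le_sum mult_nonneg_nonneg Jac_nonneg) auto
  then show ?thesis using assms by (simp add: Jac_def)
qed

theorem proposition4p5:
  fixes X \<Delta> :: "(real^'n) set"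
    and Xs :: "nat \<Rightarrow> (real^'n) set" and N :: nat
    and f :: "real^'n \<Rightarrow> real^'n"
    and \<nu> :: "real^'n \<Rightarrow> real"
    and \<epsilon> \<tau> :: real
    and \<mu> :: "(real^'n) measure"
    and p :: nat and z :: "real^'n"
    and b u :: "nat \<Rightarrow> real"
  assumes "compact X" and "X = closure (interior X)"
    and "is_norm \<nu>"
    and "\<And>i. i \<in> {1..N} \<Longrightarrow> open (Xs i)"
    and "\<And>i. i \<in> {1..N} \<Longrightarrow> Xs i \<subseteq> X"
    and "disjoint_family_on Xs {1..N}"
    and "X = (\<Union>i\<in>{1..N}. closure (Xs i))"
    and "\<Delta> = X - (\<Union>i\<in>{1..N}. Xs i)"
    and "\<Delta> \<in> null_sets (normalized_lebesgue X)"
    and "f ` X \<subseteq> X"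
    and "nonsingular (uniform_on X) f"
    and "inj_on f X"
    and "C1_diffeo_onto_image (X - \<Delta>) f"
    and "0 < \<epsilon>" and "\<epsilon> < 1"
    and "stationary_acpm \<epsilon> X f \<mu>"
    and "p \<ge> 1"
    and "z \<in> Lam X \<Delta> f p - closure (Lam X \<Delta> f (p + 1))"
    and "\<tau> > 0"
    and "\<And>n. n \<ge> 1 \<Longrightarrow>
           measure (normalized_lebesgue X) (norm_ball \<nu> z (exp (- b n))) =
             inverse (real n * \<epsilon> * (\<Sum>k=0..p. (1 - \<epsilon>) ^ k * Jac X f k z))"
    and "\<And>n. u n = - ln \<tau> / real CARD('n) + b n"
  shows "cond_D' (path_measure \<epsilon> X \<mu>) (obs_process \<nu> f z) u"
proof -
  note Lam.simps(2) [simp del]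
  interpret D: piecewise_diffeo X \<Delta> f
    using assms(10,12,13) by unfold_locales
  have z: "z \<in> Lam X \<Delta> f p - closure (Lam X \<Delta> f (Suc p))" using assms(18) by simp
  then have "z \<in> X" using D.Lam_antimono[of 0 p] by auto
  then have "X \<noteq> {}" by blast
  note X = emeasure_lebesgue_regular_compact[OF assms(1,2) this]
  have f_meas: "f \<in> measurable (uniform_on X) (uniform_on X)"
    using assms(11) unfolding nonsingular_def by blast
  interpret stationary_random_map \<epsilon> X f \<mu>
    by (intro stationary_random_map.intro random_map.intro stationary_random_map_axioms.intro
        assms(14-16) prob_space_uniform_on[OF X] f_meas)
  define m where "m = measure (normalized_lebesgue X)"
  define S where "S = \<epsilon> * (\<Sum>k=0..p. (1 - \<epsilon>) ^ k * Jac X f k z)"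
  define \<rho> where "\<rho> n = exp (- u n)" for n
  have S: "S > 0" unfolding S_def using assms(14,15) by (rule weighted_Jac_sum_pos)
  have b: "m (norm_ball \<nu> z (exp (- b n))) = 1 / (real n * S)" if "n \<ge> 1" for n
    using assms(20)[OF that] by (simp add: m_def S_def divide_inverse mult.assoc)
  have scale: "m (norm_ball \<nu> w (c * r)) = c ^ CARD('n) * m (norm_ball \<nu> z' r)" if "c > 0" for c r w z'
    using measure_norm_ball_scale[OF assms(3) that, of X w r z'] by (simp add: m_def)
  have m_rho: "m (norm_ball \<nu> z (\<rho> n)) = \<tau> / (real n * S)" if "n \<ge> 1" for n
  proof -
    have "\<rho> n = exp (ln \<tau> / real CARD('n)) * exp (- b n)"
      by (simp add: \<rho>_def assms(21) flip: exp_add)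
    moreover have "exp (ln \<tau> / real CARD('n)) ^ CARD('n) = \<tau>"
      using assms(19) by (simp flip: exp_of_nat_mult)
    ultimately show ?thesis using scale[of "exp (ln \<tau> / real CARD('n))" z "exp (- b n)" z] b[OF that] by simp
  qed
  (* The prescribed volume at n = 1 is positive, and scaling transfers this to all radii. *)
  have m_pos: "m (norm_ball \<nu> w r) > 0" if "r > 0" for r w
    using scale[of "r / exp (- b 1)" w "exp (- b 1)" z] b[of 1] S that by simp
  (* The volumes of the balls tend to 0, so by scaling their radii do as well. *)
  have small: "\<forall>\<^sub>F n in sequentially. \<rho> n \<le> r" if r: "r > 0" for r
  proof -
    have "(\<lambda>n. \<tau> / S * (1 / real n)) \<longlonglongrightarrow> \<tau> / S * 0"
      by (intro tendsto_mult_left lim_1_over_n)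
    then have "\<forall>\<^sub>F n in sequentially. \<tau> / S * (1 / real n) < m (norm_ball \<nu> z r)"
      using m_pos[OF r] by (intro order_tendstoD(2)) auto
    then show ?thesis
      using eventually_ge_at_top[of 1]
    proof eventually_elim
      case (elim n)
      show ?case
      proof (rule ccontr)
        assume "\<not> \<rho> n \<le> r"
        then have "1 \<le> (\<rho> n / r) ^ CARD('n)" using r by (intro one_le_power) auto
        then have "m (norm_ball \<nu> z r) \<le> (\<rho> n / r) ^ CARD('n) * m (norm_ball \<nu> z r)"
          using m_pos[OF r, of z] by simp
        also have "\<dots> = m (norm_ball \<nu> z (\<rho> n))"
          using scale[of "\<rho> n / r" z r z] r by (simp add: \<rho>_def)
        finally show False using elim m_rho[of n] by (simp add: mult.commute)
      qed
    qed
  qed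
  have target: "target \<nu> z (u n) = X \<inter> norm_ball \<nu> z (\<rho> n)" for n
    by (simp add: target_def[OF assms(3)] \<rho>_def)
  have target_sets: "target \<nu> z (u n) \<in> sets unif" for n
    by (rule target_sets[OF assms(3)])
  (* Bad collects the points whose orbit meets the singular set; off it all iterates are smooth. *)
  define Bad where "Bad = (\<Union>i. (f ^^ i) -` \<Delta> \<inter> X)"
  have "\<Delta> \<in> null_sets unif"
  proof -
    have "\<Delta> \<subseteq> X" using assms(8) by blast
    moreover have "\<Delta> \<in> sets lebesgue" "emeasure lebesgue \<Delta> = 0"
      using assms(9) X by (auto simp: normalized_lebesgue_def null_sets_def)
    ultimately show ?thesis
      using X(1) by (simp add: null_sets_def sets_uniform_on emeasure_uniform_on del: emeasure_completion)
  qed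
  then have "Bad \<in> null_sets unif"
    unfolding Bad_def by (intro null_sets_UN null_sets_funpow_vimage assms(11))
  then have Bad: "Bad \<in> null_sets \<mu>" by (rule null_sets_mu)
  have smooth: "(f ^^ i) x \<in> X - \<Delta>" if "x \<in> X" "x \<notin> Bad" for x i
  proof -
    have "(f ^^ i) x \<in> X" using that(1) f_closed by (induction i) auto
    then show ?thesis using that by (auto simp: Bad_def)
  qed
  have null: "A \<in> null_sets \<mu>" if "A \<in> sets unif" "A \<subseteq> Bad" for A
    using null_sets_subset[OF Bad] that by (simp add: sets_mu)
  have vimage_sets: "(f ^^ i) -` A \<inter> X \<in> sets unif" if "A \<in> sets unif" for i A
    using measurable_sets[OF funpow_measurable that, of i] by (simp add: space_uniform_on)
  obtain V where V: "open V" "z \<in> V" "V \<inter> Lam X \<Delta> f (Suc p) = {}"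
    and no_return: "\<And>x j. x \<in> X \<Longrightarrow> j \<ge> 1 \<Longrightarrow> \<forall>i<j. (f ^^ i) x \<in> X - \<Delta> \<Longrightarrow> x \<in> V \<Longrightarrow> (f ^^ j) x \<notin> V"
    by (rule D.no_return_neighbourhood[OF z]) (rule that)
  obtain r0 where r0: "r0 > 0" "norm_ball \<nu> z r0 \<subseteq> V"
    by (rule norm_ball_subset_open[OF assms(3) V(1,2)])
  have target_V: "target \<nu> z (u n) \<subseteq> V" if "\<rho> n \<le> r0" for n
    using that r0(2) unfolding target by (auto simp: norm_ball_def)
  (* Preimages of the balls lie in balls of comparable radius, hence have volume O(1 / n). *)
  have "\<exists>c\<ge>0. \<forall>\<^sub>F n in sequentially.
      emeasure unif ((f ^^ i) -` target \<nu> z (u n) \<inter> X) \<le> ennreal (c / real n)" if i: "i \<le> p" for i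
  proof -
    have "z \<in> Lam X \<Delta> f p" using z by blast
    then obtain w K r where K: "K > 0" and r: "r > 0"
      and pre: "\<And>s. s \<le> r \<Longrightarrow> {x \<in> X. (f ^^ i) x \<in> norm_ball \<nu> z s} \<subseteq> norm_ball \<nu> w (K * s)"
      by (rule D.preimage_norm_ball_subset[OF _ i assms(3)]) (rule that)
    let ?c = "K ^ CARD('n) * \<tau> / S"
    have "\<forall>\<^sub>F n in sequentially. emeasure unif ((f ^^ i) -` target \<nu> z (u n) \<inter> X) \<le> ennreal (?c / real n)"
      using small[OF r] eventually_ge_at_top[of 1]
    proof eventually_elim
      case (elim n)
      let ?B = "norm_ball \<nu> w (K * \<rho> n)"
      have "m ?B = K ^ CARD('n) * m (norm_ball \<nu> z (\<rho> n))" by (rule scale[OF K])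
      also have "\<dots> = ?c / real n" by (simp add: m_rho[OF elim(2)])
      finally have mB: "m ?B = ?c / real n" .
      have "m ?B > 0" using m_pos[of "K * \<rho> n" w] K by (simp add: \<rho>_def)
      then have "emeasure (normalized_lebesgue X) ?B \<noteq> \<top>"
        using measure_zero_top[of "normalized_lebesgue X" ?B] by (auto simp: m_def)
      then have "emeasure (normalized_lebesgue X) ?B = ennreal (?c / real n)"
        unfolding mB[symmetric] m_def by (rule emeasure_eq_ennreal_measure)
      moreover have "emeasure unif ((f ^^ i) -` target \<nu> z (u n) \<inter> X) \<le> emeasure (normalized_lebesgue X) ?B"
      proof (rule emeasure_uniform_on_le[OF X(1)])
        show "(f ^^ i) -` target \<nu> z (u n) \<inter> X \<subseteq> ?B"
          using pre[OF elim(1)] by (auto simp: target)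
        show "?B \<in> sets lebesgue"
          using open_norm_ball[OF assms(3)] by (simp add: borel_open)
      qed simp
      ultimately show ?case by simp
    qed
    moreover have "?c \<ge> 0" using K S assms(19) by simp
    ultimately show ?thesis by blast
  qed
  then have "\<forall>i\<in>{..p}. \<exists>c. c \<ge> 0 \<and> (\<forall>\<^sub>F n in sequentially.
      emeasure unif ((f ^^ i) -` target \<nu> z (u n) \<inter> X) \<le> ennreal (c / real n))"
    by blast
  from bchoice[OF this] obtain c where "\<forall>i\<in>{..p}. c i \<ge> 0 \<and> (\<forall>\<^sub>F n in sequentially.
      emeasure unif ((f ^^ i) -` target \<nu> z (u n) \<inter> X) \<le> ennreal (c i / real n))" ..
  then have c: "\<And>i. i \<le> p \<Longrightarrow> c i \<ge> 0"
    "\<And>i. i \<le> p \<Longrightarrow> \<forall>\<^sub>F n in sequentially.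
      emeasure unif ((f ^^ i) -` target \<nu> z (u n) \<inter> X) \<le> ennreal (c i / real n)"
    by simp_all
  show ?thesis
  proof (rule cond_D'_obs_process[OF assms(3)])
    show "\<forall>\<^sub>F n in sequentially. \<forall>j\<ge>1. target \<nu> z (u n) \<inter> (f ^^ j) -` target \<nu> z (u n) \<in> null_sets \<mu>"
      using small[OF r0(1)]
    proof eventually_elim
      case (elim n)
      let ?A = "target \<nu> z (u n)"
      have "?A \<inter> (f ^^ j) -` ?A \<in> null_sets \<mu>" if "j \<ge> 1" for j
      proof (rule null)
        have "?A \<inter> (f ^^ j) -` ?A = ?A \<inter> ((f ^^ j) -` ?A \<inter> X)" by (auto simp: target)
        then show "?A \<inter> (f ^^ j) -` ?A \<in> sets unif"
          using vimage_sets[OF target_sets, of j n] target_sets[of n] by simp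
        show "?A \<inter> (f ^^ j) -` ?A \<subseteq> Bad"
          using no_return[OF _ that] smooth target_V[OF elim] by (auto simp: target)
      qed
      then show ?case by blast
    qed
    have "\<forall>\<^sub>F n in sequentially. \<forall>i\<in>{..p}.
        emeasure unif ((f ^^ i) -` target \<nu> z (u n) \<inter> X) \<le> ennreal (c i / real n)"
      using c(2) by (intro eventually_ball_finite) auto
    then show "\<forall>\<^sub>F n in sequentially. real n * measure \<mu> (target \<nu> z (u n)) \<le> (\<Sum>i<Suc p. c i)"
      using small[OF r0(1)] eventually_ge_at_top[of 1]
    proof eventually_elim
      case (elim n)
      let ?A = "target \<nu> z (u n)"
      have "measure \<mu> ?A \<le> (\<Sum>i<Suc p. c i / real n)"
      proof (rule measure_stationary_le[OF target_sets])
        show "(f ^^ Suc p) -` ?A \<inter> X \<in> null_sets \<mu>"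
        proof (rule null)
          show "(f ^^ Suc p) -` ?A \<inter> X \<in> sets unif" by (rule vimage_sets[OF target_sets])
          show "(f ^^ Suc p) -` ?A \<inter> X \<subseteq> Bad"
          proof (rule ccontr)
            assume "\<not> (f ^^ Suc p) -` ?A \<inter> X \<subseteq> Bad"
            then obtain x where x: "x \<in> X" "(f ^^ Suc p) x \<in> ?A" "x \<notin> Bad" by blast
            then have "(f ^^ Suc p) x \<in> Lam X \<Delta> f (Suc p)" using D.Lam_iff smooth by blast
            then show False using x(2) V(3) target_V[OF elim(2)] by blast
          qed
        qed
        show "emeasure unif ((f ^^ i) -` ?A \<inter> X) \<le> ennreal (c i / real n)" if "i < Suc p" for i
          using elim(1) that by auto
        show "0 \<le> c i / real n" if "i < Suc p" for i
          using c(1) that by simp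
      qed
      then have "real n * measure \<mu> ?A \<le> real n * (\<Sum>i<Suc p. c i / real n)"
        by (intro mult_left_mono) auto
      also have "\<dots> = (\<Sum>i<Suc p. c i)"
        using elim(3) by (simp only: sum_divide_distrib[symmetric]) simp
      finally show ?case .
    qed
  qed
qed

end
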